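(* (Gödel's Completeness Theorem for quantifier theories.) Let $\mathbf A$ be a global locally finite quantifier theory, let $X$ be an infinite set and let $J$ be a consistent subset of $\mathbf A_*(X)$. (a) There is an infinite set $X^+$ containing $X$ and a perfect ultrafilter $I$ of $\mathbf A_*(X^+)$ containing $\{p\kappa_X\mid p\in J\}$, where $\kappa_X:X\to X^+$ is the inclusion map (regarded as a map $X\to\mathbf A^*(X^+)$). (b) For $X^+$ and $I$ as in (a), the modification $\mathbf A[X^+]/I$ of $\mathbf A$ is a $2$-model of $\mathbf A$, and in it $p\kappa_X=1$ for every $p\in J$.
   Context: Throughout, $\mathcal S$ is a nonempty collection of sets containing at least one infinite set; $X,Y,Z,W$ denote members of $\mathcal S$ (sets of variables). Quantifier theory. A quantifier theory $\mathbf A$ over $\mathcal S$ consists of: a set $\mathbf A^*(X)$ and a map $\epsilon_X:X\to\mathbf A^*(X)$ for each $X$ (one writes $x$ for $\epsilon_X(x)$); a Boolean algebra $\mathbf A_*(X)$ for each $X$; an element $a\sigma\in\mathbf A^*(Y)$ for each nonempty $X$, $a\in\mathbf A^*(X)$ and map $\sigma:X\to\mathbf A^*(Y)$; an element $p\sigma\in\mathbf A_*(Y)$ for each nonempty $X$, $p\in\mathbf A_*(X)$ and map $\sigma:X\to\mathbf A^*(Y)$; an element $\forall x.p\in\mathbf A_*(X)$ for each nonempty $X$, $x\in X$, $p\in\mathbf A_*(X)$. Put $\mathbf A(X)=\mathbf A_*(X)\cup\mathbf A^*(X)$. For all nonempty $X$, $x\in X$, $t\in\mathbf A(X)$, $\sigma:X\to\mathbf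 A^*(Y)$, $p,q\in\mathbf A_*(X)$ the following hold. (P1) $t\epsilon_X=t$. (P2) $(t\sigma)\tau=t(\sigma\tau)$ if $Y$ is nonempty and $\tau:Y\to\mathbf A^*(W)$, where $(\sigma\tau)(x)=\sigma(x)\tau$. (P3) $x\sigma=\sigma(x)$. (P4) $p\mapsto p\sigma$ is a homomorphism of Boolean algebras $\mathbf A_*(X)\to\mathbf A_*(Y)$. (P5) $(\forall x.p)\sigma=\forall y.(p\sigma^{y/x})$ whenever $y,z\in Y$, $y\ne z$ and $\sigma[z/y]=\sigma$. (Q1) $\forall x.(p\wedge q)=\forall x.p\wedge\forall x.q$. (Q2) $\forall x.p\le p$. (Q3) $\forall x.p=p$ if $p[y/x]=p$ for some $y\in X$, $y\neq x$. Notation: for $y\in Y$ and $d\in\mathbf A^*(Y)$, $[d/y]:Y\to\mathbf A^*(Y)$ sends $y$ to $d$ and every other variable to itself; for $d\in \mathbf A^*(Y)$, $\sigma^{d/x}:X\to\mathbf A^*(Y)$ sends $x$ to $d$ and agrees with $\sigma$ elsewhere. Supports. For nonempty $X$ and $t\in\mathbf A(X)$, a subset $U\subseteq X$ is a support for $t$ if $t\sigma=t\tau$ for all $Y$ and all $\sigma,\tau:X\to\mathbf A^*(Y)$ with $\sigma|_U=\tau|_U$; $t$ is closed if $\emptyset$ is a support for $t$ (elements of $\mathbf A(\emptyset)$ are by definition closed). $\mathbf A$ is locally finite if every element of every $\mathbf A(X)$ has a finite support. Standing convention: every quantifier theory considered is nontrivial, meaning that $\mathbf A_*(X)$ has a non-closed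 element for some nonempty $X\in\mathcal S$. A theory is global if $\mathcal S$ is the collection of all sets. Models. A quantifier model is a quantifier theory $\mathbf B$ over a collection containing $\emptyset$ such that (M1) $\mathbf B^*(\emptyset)\neq\emptyset$ and $\mathbf B_*(\emptyset)$ is a nontrivial Boolean algebra ($0\ne1$); (M2) for nonempty $X$, $x\in X$, $p\in\mathbf B_*(X)$, $\sigma:X\to\mathbf B^*(\emptyset)$, the infimum $\bigwedge_{d\in\mathbf B^*(\emptyset)}p\sigma^{d/x}$ exists in $\mathbf B_*(\emptyset)$ and equals $(\forall x.p)\sigma$. It is a $2$-model if $\mathbf B_*(\emptyset)=2=\{0,1\}$. A modification (resp. model, $2$-model) of a quantifier theory $\mathbf A$ over $\mathcal S$ is a quantifier theory (resp. quantifier model, $2$-model) $\mathbf B$ over $\mathcal S\cup\{\emptyset\}$ whose restriction to $\mathcal S\setminus\{\emptyset\}$ equals that of $\mathbf A$. The modification $\mathbf A[Z]$ (for nonempty $Z\in\mathcal S$) agrees with $\mathbf A$ on $\mathcal S\setminus\{\emptyset\}$, has $\mathbf A[Z]_*(\emptyset)=\mathbf A_*(Z)$ and $\mathbf A[Z]^*(\emptyset)=\mathbf A^*(Z)$, and for $\sigma:X\to\mathbf A^*(Z)$ the element $t\sigma$ is the one given in $\mathbf A$. For a filter $I$ of $\mathbf A_*(Z)$, $\mathbf A[Z]/I$ is the modification that agrees with $\mathbf A[Z]$ except that its Boolean algebra at $\emptyset$ is the quotient $\mathbf A_*(Z)/I$, with $p\sigma$ replaced by its class. For an ultrafilter $I$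 the quotient is identified with $2$. Consistent and perfect. A subset of a Boolean algebra is consistent if it is contained in a proper filter (equivalently, finite meets of its elements are nonzero); an ultrafilter is a maximal consistent subset. For $\mathbf A$ locally finite and $Z\in\mathcal S$ infinite, an ultrafilter $I$ of $\mathbf A_*(Z)$ is perfect if for all $z\in Z$ and $q\in\mathbf A_*(Z)$ there is $d\in\mathbf A^*(Z)$ with $(\forall z.q)\vee\neg(q[d/z])\in I$. *)

theory Defs
  imports Main "HOL-Library.FuncSet"
begin

(* HOL has no collection of all sets, so an ambient universe of sets is a type 'a with a
   membership structure: elts x is the extension of the set x. Only those ZFC axioms are
   required that are listed below (separation, replacement and union are second-order, and
   choice is available in HOL). Every second-order model of ZFC is thus a set_universe, as is,
   for example, the universe of hereditarily countable sets. *)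
class set_universe =
  fixes elts :: "'a \<Rightarrow> 'a set"
  assumes extensionality: "elts x = elts y \<Longrightarrow> x = y"
    and separation: "V \<subseteq> elts x \<Longrightarrow> \<exists>u. elts u = V"
    and replacement: "\<exists>u. elts u = f ` elts x"
    and union: "\<exists>u. elts u = \<Union> (elts ` elts x)"
    and infinity: "\<exists>x. infinite (elts x)"

(* A HOL set V is a set of the universe (as opposed to a proper class) iff it is small;
   set_of V is then the corresponding element of the universe. *)
definition small :: "'v::set_universe set \<Rightarrow> bool" where
  "small V \<longleftrightarrow> V \<in> range elts"

definition set_of :: "'v::set_universe set \<Rightarrow> 'v" where
  "set_of = inv elts"


section \<open>Boolean algebras\<close>

record 'a boolalg =
  carrier :: "'a set"
  meet :: "'a \<Rightarrow> 'a \<Rightarrow> 'a"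
  join :: "'a \<Rightarrow> 'a \<Rightarrow> 'a"
  neg :: "'a \<Rightarrow> 'a"
  bot :: "'a"
  top :: "'a"

hide_const (open) bot top

locale bool_algebra =
  fixes L :: "'a boolalg"
  assumes meet_closed: "\<lbrakk>p \<in> carrier L; q \<in> carrier L\<rbrakk> \<Longrightarrow> meet L p q \<in> carrier L"
    and join_closed: "\<lbrakk>p \<in> carrier L; q \<in> carrier L\<rbrakk> \<Longrightarrow> join L p q \<in> carrier L"
    and neg_closed: "p \<in> carrier L \<Longrightarrow> neg L p \<in> carrier L"
    and bot_closed: "boolalg.bot L \<in> carrier L"
    and top_closed: "boolalg.top L \<in> carrier L"
    and meet_assoc: "\<lbrakk>p \<in> carrier L; q \<in> carrier L; r \<in> carrier L\<rbrakk>
      \<Longrightarrow> meet L (meet L p q) r = meet L p (meet L q r)"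
    and join_assoc: "\<lbrakk>p \<in> carrier L; q \<in> carrier L; r \<in> carrier L\<rbrakk>
      \<Longrightarrow> join L (join L p q) r = join L p (join L q r)"
    and meet_comm: "\<lbrakk>p \<in> carrier L; q \<in> carrier L\<rbrakk> \<Longrightarrow> meet L p q = meet L q p"
    and join_comm: "\<lbrakk>p \<in> carrier L; q \<in> carrier L\<rbrakk> \<Longrightarrow> join L p q = join L q p"
    and meet_join_distrib: "\<lbrakk>p \<in> carrier L; q \<in> carrier L; r \<in> carrier L\<rbrakk>
      \<Longrightarrow> meet L p (join L q r) = join L (meet L p q) (meet L p r)"
    and join_meet_distrib: "\<lbrakk>p \<in> carrier L; q \<in> carrier L; r \<in> carrier L\<rbrakk>
      \<Longrightarrow> join L p (meet L q r) = meet L (join L p q) (join L p r)"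
    and meet_top: "p \<in> carrier L \<Longrightarrow> meet L p (boolalg.top L) = p"
    and join_bot: "p \<in> carrier L \<Longrightarrow> join L p (boolalg.bot L) = p"
    and meet_neg: "p \<in> carrier L \<Longrightarrow> meet L p (neg L p) = boolalg.bot L"
    and join_neg: "p \<in> carrier L \<Longrightarrow> join L p (neg L p) = boolalg.top L"

definition ble :: "'a boolalg \<Rightarrow> 'a \<Rightarrow> 'a \<Rightarrow> bool" where
  "ble L p q \<longleftrightarrow> meet L p q = p"

definition bool_hom :: "'a boolalg \<Rightarrow> 'b boolalg \<Rightarrow> ('a \<Rightarrow> 'b) \<Rightarrow> bool" where
  "bool_hom L M h \<longleftrightarrow>
     h \<in> carrier L \<rightarrow> carrier M \<and>
     (\<forall>p\<in>carrier L. \<forall>q\<in>carrier L.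
        h (meet L p q) = meet M (h p) (h q) \<and> h (join L p q) = join M (h p) (h q)) \<and>
     (\<forall>p\<in>carrier L. h (neg L p) = neg M (h p)) \<and>
     h (boolalg.bot L) = boolalg.bot M \<and> h (boolalg.top L) = boolalg.top M"

(* Equality of Boolean algebras as structured sets: the operations of a record are
   HOL functions whose values outside the carrier carry no meaning. *)
definition same_bool_algebra :: "'a boolalg \<Rightarrow> 'a boolalg \<Rightarrow> bool" where
  "same_bool_algebra L M \<longleftrightarrow>
     carrier L = carrier M \<and>
     (\<forall>p\<in>carrier L. \<forall>q\<in>carrier L. meet L p q = meet M p q \<and> join L p q = join M p q) \<and>
     (\<forall>p\<in>carrier L. neg L p = neg M p) \<and>
     boolalg.bot L = boolalg.bot M \<and> boolalg.top L = boolalg.top M"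

definition is_infimum :: "'a boolalg \<Rightarrow> 'a set \<Rightarrow> 'a \<Rightarrow> bool" where
  "is_infimum L P m \<longleftrightarrow>
     m \<in> carrier L \<and> (\<forall>p\<in>P. ble L m p) \<and>
     (\<forall>l\<in>carrier L. (\<forall>p\<in>P. ble L l p) \<longrightarrow> ble L l m)"

definition is_filter :: "'a boolalg \<Rightarrow> 'a set \<Rightarrow> bool" where
  "is_filter L F \<longleftrightarrow>
     F \<subseteq> carrier L \<and> F \<noteq> {} \<and>
     (\<forall>p\<in>F. \<forall>q\<in>F. meet L p q \<in> F) \<and>
     (\<forall>p\<in>F. \<forall>q\<in>carrier L. ble L p q \<longrightarrow> q \<in> F)"

definition consistent :: "'a boolalg \<Rightarrow> 'a set \<Rightarrow> bool" where
  "consistent L J \<longleftrightarrow> (\<exists>F. is_filter L F \<and> F \<noteq> carrier L \<and> J \<subseteq> F)"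

definition ultrafilter :: "'a boolalg \<Rightarrow> 'a set \<Rightarrow> bool" where
  "ultrafilter L I \<longleftrightarrow> consistent L I \<and> (\<forall>K. consistent L K \<and> I \<subseteq> K \<longrightarrow> K = I)"

(* The quotient of L by a filter I. The class of p consists of all q such that the
   biconditional of p and q lies in I; it is a set, hence an element of the universe. *)
definition quot_class :: "'v::set_universe boolalg \<Rightarrow> 'v set \<Rightarrow> 'v \<Rightarrow> 'v" where
  "quot_class L I p =
     set_of {q \<in> carrier L. meet L (join L (neg L p) q) (join L (neg L q) p) \<in> I}"

definition quot_rep :: "'v::set_universe \<Rightarrow> 'v" where
  "quot_rep c = (SOME p. p \<in> elts c)"

definition quotient_algebra :: "'v::set_universe boolalg \<Rightarrow> 'v set \<Rightarrow> 'v boolalg" where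
  "quotient_algebra L I =
     \<lparr>carrier = quot_class L I ` carrier L,
      meet = (\<lambda>c d. quot_class L I (meet L (quot_rep c) (quot_rep d))),
      join = (\<lambda>c d. quot_class L I (join L (quot_rep c) (quot_rep d))),
      neg = (\<lambda>c. quot_class L I (neg L (quot_rep c))),
      bot = quot_class L I (boolalg.bot L),
      top = quot_class L I (boolalg.top L)\<rparr>"


section \<open>Quantifier theories\<close>

(* terms A X and forms A X are the upper-star and the lower-star part of A at X. Maps
   X -> terms A Y are represented by the extensional functions in X \<rightarrow>\<^sub>E terms A Y. The
   substitutions tsub A X Y a s and fsub A X Y p s carry the domain X and the codomain index Y
   of the map s explicitly. *)
record 'v qtheory =
  terms :: "'v set \<Rightarrow> 'v set"
  var :: "'v set \<Rightarrow> 'v \<Rightarrow> 'v"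
  forms :: "'v set \<Rightarrow> 'v boolalg"
  tsub :: "'v set \<Rightarrow> 'v set \<Rightarrow> 'v \<Rightarrow> ('v \<Rightarrow> 'v) \<Rightarrow> 'v"
  fsub :: "'v set \<Rightarrow> 'v set \<Rightarrow> 'v \<Rightarrow> ('v \<Rightarrow> 'v) \<Rightarrow> 'v"
  all :: "'v set \<Rightarrow> 'v \<Rightarrow> 'v \<Rightarrow> 'v"

abbreviation fcarrier :: "'v qtheory \<Rightarrow> 'v set \<Rightarrow> 'v set" where
  "fcarrier A X \<equiv> carrier (forms A X)"

definition scomp :: "'v qtheory \<Rightarrow> 'v set \<Rightarrow> 'v set \<Rightarrow> 'v set
    \<Rightarrow> ('v \<Rightarrow> 'v) \<Rightarrow> ('v \<Rightarrow> 'v) \<Rightarrow> 'v \<Rightarrow> 'v" where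
  "scomp A X Y W \<sigma> \<tau> = (\<lambda>x\<in>X. tsub A Y W (\<sigma> x) \<tau>)"

(* For U \<subseteq> X this is the inclusion U \<rightarrow> X regarded as a map into terms A X;
   for U = X it is the map epsilon of the theory. *)
definition incl :: "'v qtheory \<Rightarrow> 'v set \<Rightarrow> 'v set \<Rightarrow> 'v \<Rightarrow> 'v" where
  "incl A U X = (\<lambda>x\<in>U. var A X x)"

(* The map [d/y] from Y to terms A Y. The map written with superscript d/x in the literature is
   the function update \<sigma>(x := d), which is again extensional on X for x \<in> X. *)
definition single :: "'v qtheory \<Rightarrow> 'v set \<Rightarrow> 'v \<Rightarrow> 'v \<Rightarrow> 'v \<Rightarrow> 'v" where
  "single A Y d y = (incl A Y Y)(y := d)"

(* Over the empty set substitution is not available, and all elements count as closed. *)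
definition term_support :: "'v set set \<Rightarrow> 'v qtheory \<Rightarrow> 'v set \<Rightarrow> 'v \<Rightarrow> 'v set \<Rightarrow> bool" where
  "term_support S A X a U \<longleftrightarrow>
     U \<subseteq> X \<and>
     (X \<noteq> {} \<longrightarrow> (\<forall>Y\<in>S. \<forall>\<sigma> \<in> X \<rightarrow>\<^sub>E terms A Y. \<forall>\<tau> \<in> X \<rightarrow>\<^sub>E terms A Y.
        (\<forall>x\<in>U. \<sigma> x = \<tau> x) \<longrightarrow> tsub A X Y a \<sigma> = tsub A X Y a \<tau>))"

definition form_support :: "'v set set \<Rightarrow> 'v qtheory \<Rightarrow> 'v set \<Rightarrow> 'v \<Rightarrow> 'v set \<Rightarrow> bool" where
  "form_support S A X p U \<longleftrightarrow>
     U \<subseteq> X \<and>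
     (X \<noteq> {} \<longrightarrow> (\<forall>Y\<in>S. \<forall>\<sigma> \<in> X \<rightarrow>\<^sub>E terms A Y. \<forall>\<tau> \<in> X \<rightarrow>\<^sub>E terms A Y.
        (\<forall>x\<in>U. \<sigma> x = \<tau> x) \<longrightarrow> fsub A X Y p \<sigma> = fsub A X Y p \<tau>))"

definition closed_form :: "'v set set \<Rightarrow> 'v qtheory \<Rightarrow> 'v set \<Rightarrow> 'v \<Rightarrow> bool" where
  "closed_form S A X p \<longleftrightarrow> form_support S A X p {}"

(* The last assumption is the standing convention that quantifier theories are nontrivial. *)
locale quantifier_theory =
  fixes S :: "'v::set_universe set set" and A :: "'v qtheory"
  assumes sets: "X \<in> S \<Longrightarrow> small X"
    and infinite_set: "\<exists>X\<in>S. infinite X"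
    and terms_small: "X \<in> S \<Longrightarrow> small (terms A X)"
    and forms_small: "X \<in> S \<Longrightarrow> small (fcarrier A X)"
    and var_closed: "X \<in> S \<Longrightarrow> var A X \<in> X \<rightarrow> terms A X"
    and forms_algebra: "X \<in> S \<Longrightarrow> bool_algebra (forms A X)"
    and tsub_closed: "\<lbrakk>X \<in> S; X \<noteq> {}; Y \<in> S; a \<in> terms A X; \<sigma> \<in> X \<rightarrow>\<^sub>E terms A Y\<rbrakk>
      \<Longrightarrow> tsub A X Y a \<sigma> \<in> terms A Y"
    and fsub_closed: "\<lbrakk>X \<in> S; X \<noteq> {}; Y \<in> S; p \<in> fcarrier A X; \<sigma> \<in> X \<rightarrow>\<^sub>E terms A Y\<rbrakk>
      \<Longrightarrow> fsub A X Y p \<sigma> \<in> fcarrier A Y"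
    and all_closed: "\<lbrakk>X \<in> S; x \<in> X; p \<in> fcarrier A X\<rbrakk> \<Longrightarrow> all A X x p \<in> fcarrier A X"
    and P1_term: "\<lbrakk>X \<in> S; X \<noteq> {}; a \<in> terms A X\<rbrakk> \<Longrightarrow> tsub A X X a (incl A X X) = a"
    and P1_form: "\<lbrakk>X \<in> S; X \<noteq> {}; p \<in> fcarrier A X\<rbrakk> \<Longrightarrow> fsub A X X p (incl A X X) = p"
    and P2_term: "\<lbrakk>X \<in> S; X \<noteq> {}; Y \<in> S; Y \<noteq> {}; W \<in> S; a \<in> terms A X;
        \<sigma> \<in> X \<rightarrow>\<^sub>E terms A Y; \<tau> \<in> Y \<rightarrow>\<^sub>E terms A W\<rbrakk>
      \<Longrightarrow> tsub A Y W (tsub A X Y a \<sigma>) \<tau> = tsub A X W a (scomp A X Y W \<sigma> \<tau>)"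
    and P2_form: "\<lbrakk>X \<in> S; X \<noteq> {}; Y \<in> S; Y \<noteq> {}; W \<in> S; p \<in> fcarrier A X;
        \<sigma> \<in> X \<rightarrow>\<^sub>E terms A Y; \<tau> \<in> Y \<rightarrow>\<^sub>E terms A W\<rbrakk>
      \<Longrightarrow> fsub A Y W (fsub A X Y p \<sigma>) \<tau> = fsub A X W p (scomp A X Y W \<sigma> \<tau>)"
    and P3: "\<lbrakk>X \<in> S; x \<in> X; Y \<in> S; \<sigma> \<in> X \<rightarrow>\<^sub>E terms A Y\<rbrakk>
      \<Longrightarrow> tsub A X Y (var A X x) \<sigma> = \<sigma> x"
    and P4: "\<lbrakk>X \<in> S; X \<noteq> {}; Y \<in> S; \<sigma> \<in> X \<rightarrow>\<^sub>E terms A Y\<rbrakk>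
      \<Longrightarrow> bool_hom (forms A X) (forms A Y) (\<lambda>p. fsub A X Y p \<sigma>)"
    and P5: "\<lbrakk>X \<in> S; x \<in> X; Y \<in> S; p \<in> fcarrier A X; \<sigma> \<in> X \<rightarrow>\<^sub>E terms A Y;
        y \<in> Y; z \<in> Y; y \<noteq> z; scomp A X Y Y \<sigma> (single A Y (var A Y z) y) = \<sigma>\<rbrakk>
      \<Longrightarrow> fsub A X Y (all A X x p) \<sigma> = all A Y y (fsub A X Y p (\<sigma>(x := var A Y y)))"
    and Q1: "\<lbrakk>X \<in> S; x \<in> X; p \<in> fcarrier A X; q \<in> fcarrier A X\<rbrakk>
      \<Longrightarrow> all A X x (meet (forms A X) p q) = meet (forms A X) (all A X x p) (all A X x q)"
    and Q2: "\<lbrakk>X \<in> S; x \<in> X; p \<in> fcarrier A X\<rbrakk> \<Longrightarrow> ble (forms A X) (all A X x p) p"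
    and Q3: "\<lbrakk>X \<in> S; x \<in> X; p \<in> fcarrier A X; y \<in> X; y \<noteq> x;
        fsub A X X p (single A X (var A X y) x) = p\<rbrakk> \<Longrightarrow> all A X x p = p"
    and nontrivial: "\<exists>X\<in>S. X \<noteq> {} \<and> (\<exists>p\<in>fcarrier A X. \<not> closed_form S A X p)"

definition locally_finite :: "'v set set \<Rightarrow> 'v qtheory \<Rightarrow> bool" where
  "locally_finite S A \<longleftrightarrow>
     (\<forall>X\<in>S. (\<forall>a\<in>terms A X. \<exists>U. finite U \<and> term_support S A X a U) \<and>
            (\<forall>p\<in>fcarrier A X. \<exists>U. finite U \<and> form_support S A X p U))"


section \<open>Models\<close>

locale quantifier_model = quantifier_theory S B
  for S :: "'v::set_universe set set" and B :: "'v qtheory" +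
  assumes empty_in: "{} \<in> S"
    and M1_terms: "terms B {} \<noteq> {}"
    and M1_forms: "boolalg.bot (forms B {}) \<noteq> boolalg.top (forms B {})"
    and M2: "\<lbrakk>X \<in> S; x \<in> X; p \<in> fcarrier B X; \<sigma> \<in> X \<rightarrow>\<^sub>E terms B {}\<rbrakk>
      \<Longrightarrow> is_infimum (forms B {}) ((\<lambda>d. fsub B X {} p (\<sigma>(x := d))) ` terms B {})
            (fsub B X {} (all B X x p) \<sigma>)"

(* The two-element Boolean algebra is identified with the quotients that have exactly the
   elements 0 and 1 (which are distinct in a model). *)
locale two_model = quantifier_model +
  assumes two: "fcarrier B {} = {boolalg.bot (forms B {}), boolalg.top (forms B {})}"

(* Equality of the restrictions of A and B to the collection T. *)
definition agree_on :: "'v set set \<Rightarrow> 'v qtheory \<Rightarrow> 'v qtheory \<Rightarrow> bool" where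
  "agree_on T A B \<longleftrightarrow>
     (\<forall>X\<in>T. terms A X = terms B X \<and> (\<forall>x\<in>X. var A X x = var B X x) \<and>
        same_bool_algebra (forms A X) (forms B X) \<and>
        (\<forall>x\<in>X. \<forall>p\<in>fcarrier A X. all A X x p = all B X x p) \<and>
        (X \<noteq> {} \<longrightarrow> (\<forall>Y\<in>T. \<forall>\<sigma> \<in> X \<rightarrow>\<^sub>E terms A Y.
           (\<forall>a\<in>terms A X. tsub A X Y a \<sigma> = tsub B X Y a \<sigma>) \<and>
           (\<forall>p\<in>fcarrier A X. fsub A X Y p \<sigma> = fsub B X Y p \<sigma>))))"

definition modification_of :: "'v::set_universe set set \<Rightarrow> 'v qtheory \<Rightarrow> 'v qtheory \<Rightarrow> bool" where
  "modification_of S A B \<longleftrightarrow> quantifier_theory (insert {} S) B \<and> agree_on (S - {{}}) A B"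

definition two_model_of :: "'v::set_universe set set \<Rightarrow> 'v qtheory \<Rightarrow> 'v qtheory \<Rightarrow> bool" where
  "two_model_of S A B \<longleftrightarrow> modification_of S A B \<and> two_model (insert {} S) B"

(* The modification A[Z]: the empty set receives the data that A has at Z. *)
definition modif :: "'v qtheory \<Rightarrow> 'v set \<Rightarrow> 'v qtheory" where
  "modif A Z = A
     \<lparr>terms := (terms A)({} := terms A Z),
      forms := (forms A)({} := forms A Z),
      tsub := (\<lambda>X Y. tsub A X (if Y = {} then Z else Y)),
      fsub := (\<lambda>X Y. fsub A X (if Y = {} then Z else Y))\<rparr>"

(* The modification A[Z]/I. *)
definition modif_quot :: "'v::set_universe qtheory \<Rightarrow> 'v set \<Rightarrow> 'v set \<Rightarrow> 'v qtheory" where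
  "modif_quot A Z I = (modif A Z)
     \<lparr>forms := (forms (modif A Z))({} := quotient_algebra (forms A Z) I),
      fsub := (\<lambda>X Y p \<sigma>. if Y = {} then quot_class (forms A Z) I (fsub (modif A Z) X {} p \<sigma>)
                            else fsub (modif A Z) X Y p \<sigma>)\<rparr>"

definition perfect_ultrafilter :: "'v qtheory \<Rightarrow> 'v set \<Rightarrow> 'v set \<Rightarrow> bool" where
  "perfect_ultrafilter A Z I \<longleftrightarrow>
     ultrafilter (forms A Z) I \<and>
     (\<forall>z\<in>Z. \<forall>q\<in>fcarrier A Z. \<exists>d\<in>terms A Z.
        join (forms A Z) (all A Z z q) (neg (forms A Z) (fsub A Z Z q (single A Z d z))) \<in> I)"

end

(* (a) Adjoin to X, countably often, one new variable for every pair of a variable z and a formula q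
   over the set V reached so far; let Y be the union. The Henkin axiom of (z, q) states that q holds
   for all z as soon as it holds for the new variable. A nonzero formula c in which that variable d
   does not occur remains nonzero when the axiom is added: if the meet of c and the axiom is 0, then
   c \<le> q(d), and generalising over d gives c \<le> (all z q), while c meets (all z q) in 0. Hence J and
   the Henkin axioms generate a proper filter. By local finiteness every formula over Y comes from
   some V, so each ultrafilter extending that filter is perfect.

   (b) By local finiteness an instance (all x p)\<sigma> equals all y q for a variable y that \<sigma> does not use on
   the supports, and the elements p\<sigma>(x := d) are the instances q[d/y]. Modulo a perfect ultrafilter
   all y q is 1 iff all of them are. *)

theory Submission
  imports Defs
begin

section \<open>Small sets\<close>

lemma small_subset: "small V \<Longrightarrow> U \<subseteq> V \<Longrightarrow> small U"
  using separation unfolding small_def by (metis imageE rangeI)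

lemma small_image:
  fixes f :: "'v::set_universe \<Rightarrow> 'v"
  assumes "small V"
  shows "small (f ` V)"
proof -
  obtain x where "V = elts x"
    using assms unfolding small_def by blast
  then show ?thesis
    using replacement[of f x] unfolding small_def by (metis rangeI)
qed

lemma elts_set_of: "small V \<Longrightarrow> elts (set_of V) = V"
  unfolding small_def set_of_def by (auto simp: f_inv_into_f)

text \<open>The axiom \<open>infinity\<close> yields some infinite set. A countable subset of it is
  small by separation, and replacement carries that subset onto the range of any sequence.\<close>

lemma small_range_nat: "small (range (f :: nat \<Rightarrow> 'v::set_universe))"
proof -
  obtain x :: 'v where "infinite (elts x)"
    using infinity by blast
  then obtain g :: "nat \<Rightarrow> 'v" where g: "inj g" "range g \<subseteq> elts x"
    using infinite_countable_subset by blast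
  then have "small (range g)"
    using small_subset unfolding small_def by blast
  then have "small ((f \<circ> inv g) ` range g)"
    by (rule small_image)
  moreover have "(f \<circ> inv g) ` range g = range f"
    using g(1) by (auto simp: image_image)
  ultimately show ?thesis
    by simp
qed

text \<open>The axiom \<open>union\<close> applies to sets of codes, so the family is first turned
  into the small set of the elements \<open>set_of (F v)\<close>.\<close>

lemma small_UN:
  fixes F :: "'v::set_universe \<Rightarrow> 'v set"
  assumes "small V" and F: "\<And>v. v \<in> V \<Longrightarrow> small (F v)"
  shows "small (\<Union>v\<in>V. F v)"
proof -
  have "small ((\<lambda>v. set_of (F v)) ` V)"
    using assms(1) by (rule small_image)
  then obtain u where u: "elts u = (\<lambda>v. set_of (F v)) ` V"
    unfolding small_def by (metis imageE)
  then have "\<Union> (elts ` elts u) = (\<Union>v\<in>V. F v)"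
    using elts_set_of[OF F] by (simp add: image_image)
  then show ?thesis
    using union[of u] unfolding small_def by (metis rangeI)
qed

text \<open>The index type \<open>nat\<close> is no set of the universe; the range of the codes of
  the \<open>V n\<close> serves as index set instead.\<close>

lemma small_UN_nat:
  fixes V :: "nat \<Rightarrow> 'v::set_universe set"
  assumes "\<And>n. small (V n)"
  shows "small (\<Union>n. V n)"
proof -
  have "small (\<Union>v\<in>range (\<lambda>n. set_of (V n)). elts v)"
    by (rule small_UN[OF small_range_nat]) (simp add: small_def)
  then show ?thesis
    using assms by (simp add: elts_set_of)
qed

lemma small_Un:
  assumes "small V" "small W"
  shows "small (V \<union> W)"
proof -
  have "V \<union> W = (\<Union>n::nat. if n = 0 then V else W)"
    by (auto split: if_splits)
  then show ?thesis
    using small_UN_nat[of "\<lambda>n. if n = 0 then V else W"] assms by simp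
qed

text \<open>Russell's paradox: separation would make a set out of all sets that are not members of
  themselves.\<close>

lemma not_small_UNIV: "\<not> small (UNIV :: 'v::set_universe set)"
proof
  assume "small (UNIV :: 'v set)"
  then obtain u :: 'v where "elts u = {v. v \<notin> elts v}"
    using small_subset unfolding small_def by (metis imageE subset_UNIV)
  then show False
    by blast
qed

lemma small_image_Times:
  fixes V W :: "'v::set_universe set" and f :: "'v \<times> 'v \<Rightarrow> 'v"
  assumes "small V" "small W"
  shows "small (f ` (V \<times> W))"
proof -
  have "f ` (V \<times> W) = (\<Union>v\<in>V. (\<lambda>w. f (v, w)) ` W)"
    by auto
  then show ?thesis
    using assms by (auto intro!: small_UN small_image)
qed

lemma small_empty: "small {}"
  using small_subset[OF small_range_nat] by blast

section \<open>Fresh variables outside a small set\<close>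

unbundle cardinal_syntax

text \<open>If \<open>V \<times> W\<close> did not embed into the complement of \<open>U\<close>,
  comparability of cardinals would make that complement an image of \<open>V \<times> W\<close>,
  hence small, and then the whole universe would be small.\<close>

lemma fresh_inj_Times:
  fixes U V W :: "'v::set_universe set"
  assumes "small U" "small V" "small W"
  shows "\<exists>f. inj_on f (V \<times> W) \<and> f ` (V \<times> W) \<inter> U = {}"
proof (rule ccontr)
  assume no: "\<not> ?thesis"
  have "\<not> |V \<times> W| \<le>o |- U|"
    using no by (auto simp: card_of_ordLeq[symmetric])
  then have "|- U| \<le>o |V \<times> W|"
    using ordLeq_total[OF card_of_Well_order card_of_Well_order] by blast
  then obtain g where g: "inj_on g (- U)" "g ` (- U) \<subseteq> V \<times> W"
    by (auto simp: card_of_ordLeq[symmetric])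
  have "- U \<subseteq> inv_into (- U) g ` (V \<times> W)"
  proof
    fix u assume u: "u \<in> - U"
    then have "u = inv_into (- U) g (g u)"
      using inv_into_f_f[OF g(1) u] by simp
    moreover have "g u \<in> V \<times> W"
      using g(2) u by blast
    ultimately show "u \<in> inv_into (- U) g ` (V \<times> W)"
      by (rule image_eqI)
  qed
  then have "small (- U)"
    using small_subset small_image_Times[OF assms(2,3)] by blast
  then have "small (U \<union> - U)"
    using assms(1) small_Un by blast
  then show False
    by (simp add: not_small_UNIV)
qed

lemma fresh_copy:
  fixes V :: "'v::set_universe set"
  assumes "small V"
  shows "\<exists>f. inj_on f V \<and> f ` V \<inter> V = {}"
proof (cases "V = {}")
  case False
  then obtain v where "v \<in> V"
    by blast
  obtain f where f: "inj_on f (V \<times> V)" "f ` (V \<times> V) \<inter> V = {}"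
    using fresh_inj_Times[OF assms assms assms] by blast
  have "inj_on (\<lambda>x. f (x, v)) V"
    using f(1) \<open>v \<in> V\<close> by (auto simp: inj_on_def)
  moreover have "(\<lambda>x. f (x, v)) ` V \<inter> V = {}"
    using f(2) \<open>v \<in> V\<close> by blast
  ultimately show ?thesis
    by blast
qed auto


section \<open>Boolean algebras and ultrafilters\<close>

context bool_algebra
begin

lemmas bool_closed = meet_closed join_closed neg_closed bot_closed top_closed

lemma meet_idem: "p \<in> carrier L \<Longrightarrow> meet L p p = p"
  using meet_join_distrib[of p p "neg L p"] by (simp add: bool_closed meet_top join_neg meet_neg join_bot)

lemma meet_bot: "p \<in> carrier L \<Longrightarrow> meet L p (boolalg.bot L) = boolalg.bot L"
  using meet_assoc[of p p "neg L p"] by (simp add: bool_closed meet_neg meet_idem)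

lemma ble_refl: "p \<in> carrier L \<Longrightarrow> ble L p p"
  by (simp add: ble_def meet_idem)

lemma ble_trans:
  "\<lbrakk>p \<in> carrier L; q \<in> carrier L; r \<in> carrier L; ble L p q; ble L q r\<rbrakk> \<Longrightarrow> ble L p r"
  using meet_assoc[of p q r] by (simp add: ble_def)

lemma bot_ble: "p \<in> carrier L \<Longrightarrow> ble L (boolalg.bot L) p"
  using meet_comm[of p "boolalg.bot L"] by (simp add: ble_def meet_bot bot_closed)

lemma ble_top: "p \<in> carrier L \<Longrightarrow> ble L p (boolalg.top L)"
  by (simp add: ble_def meet_top)

lemma meet_ble1: "\<lbrakk>p \<in> carrier L; q \<in> carrier L\<rbrakk> \<Longrightarrow> ble L (meet L p q) p"
  by (metis ble_def meet_assoc meet_comm meet_idem)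

lemma meet_ble2: "\<lbrakk>p \<in> carrier L; q \<in> carrier L\<rbrakk> \<Longrightarrow> ble L (meet L p q) q"
  by (metis ble_def meet_assoc meet_idem)

lemma ble_meetI:
  "\<lbrakk>p \<in> carrier L; q \<in> carrier L; r \<in> carrier L; ble L r p; ble L r q\<rbrakk> \<Longrightarrow> ble L r (meet L p q)"
  by (metis ble_def meet_assoc)

lemma ble_join1: "\<lbrakk>p \<in> carrier L; q \<in> carrier L\<rbrakk> \<Longrightarrow> ble L p (join L p q)"
  using join_meet_distrib[of p "boolalg.bot L" q] meet_comm[of q "boolalg.bot L"]
  by (simp add: ble_def bool_closed join_bot meet_bot)

lemma ble_join2: "\<lbrakk>p \<in> carrier L; q \<in> carrier L\<rbrakk> \<Longrightarrow> ble L q (join L p q)"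
  using ble_join1[of q p] join_comm by simp

lemma join_bleI:
  "\<lbrakk>p \<in> carrier L; q \<in> carrier L; r \<in> carrier L; ble L p r; ble L q r\<rbrakk> \<Longrightarrow> ble L (join L p q) r"
  unfolding ble_def by (metis join_closed meet_comm meet_join_distrib)

lemma join_mono1:
  "\<lbrakk>p \<in> carrier L; q \<in> carrier L; r \<in> carrier L; ble L p q\<rbrakk> \<Longrightarrow> ble L (join L p r) (join L q r)"
  by (meson ble_join1 ble_join2 ble_trans join_bleI join_closed)

lemma ble_bot: "\<lbrakk>p \<in> carrier L; ble L p (boolalg.bot L)\<rbrakk> \<Longrightarrow> p = boolalg.bot L"
  by (simp add: ble_def meet_bot)

lemma ble_neg_if_disjoint:
  assumes "p \<in> carrier L" "q \<in> carrier L" "meet L p q = boolalg.bot L"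
  shows "ble L p (neg L q)"
proof -
  have "p = meet L p (join L q (neg L q))"
    using assms by (simp add: join_neg meet_top)
  also have "\<dots> = join L (meet L p (neg L q)) (boolalg.bot L)"
    using assms by (simp add: meet_join_distrib join_comm bool_closed)
  finally show ?thesis
    using assms by (simp add: ble_def join_bot bool_closed)
qed

lemma ble_if_disjoint_neg:
  assumes "p \<in> carrier L" "q \<in> carrier L" "meet L p (neg L q) = boolalg.bot L"
  shows "ble L p q"
proof -
  have "p = meet L p (join L q (neg L q))"
    using assms by (simp add: join_neg meet_top)
  also have "\<dots> = join L (meet L p q) (boolalg.bot L)"
    using assms by (simp add: meet_join_distrib bool_closed)
  finally show ?thesis
    using assms by (simp add: ble_def join_bot bool_closed)
qed

lemma filter_top: "is_filter L F \<Longrightarrow> boolalg.top L \<in> F"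
  unfolding is_filter_def using ble_top top_closed by blast

lemma filter_proper_iff: "is_filter L F \<Longrightarrow> F \<noteq> carrier L \<longleftrightarrow> boolalg.bot L \<notin> F"
  unfolding is_filter_def using bot_ble bot_closed by blast

text \<open>Zorn's lemma, applied to the proper filters that contain \<open>K\<close>.\<close>

lemma ex_ultrafilter:
  assumes K: "is_filter L K" "boolalg.bot L \<notin> K"
  shows "\<exists>I. ultrafilter L I \<and> K \<subseteq> I"
proof -
  define P where "P = {F. is_filter L F \<and> boolalg.bot L \<notin> F \<and> K \<subseteq> F}"
  have "\<exists>M\<in>P. \<forall>F\<in>P. M \<subseteq> F \<longrightarrow> F = M"
  proof (rule subset_Zorn_nonempty)
    show "P \<noteq> {}"
      using K by (auto simp: P_def)
  next
    fix C assume C: "C \<noteq> {}" "subset.chain P C"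
    have mem: "is_filter L F" "boolalg.bot L \<notin> F" "K \<subseteq> F" if "F \<in> C" for F
      using C(2) that by (auto simp: subset.chain_def P_def)
    have chain: "F \<subseteq> G \<or> G \<subseteq> F" if "F \<in> C" "G \<in> C" for F G
      using C(2) that by (auto simp: subset.chain_def)
    have "is_filter L (\<Union>C)"
      unfolding is_filter_def
    proof (intro conjI ballI impI)
      show "\<Union>C \<subseteq> carrier L"
        using mem(1) unfolding is_filter_def by blast
      show "\<Union>C \<noteq> {}"
        using mem(1) C(1) unfolding is_filter_def by blast
    next
      fix p q assume "p \<in> \<Union>C" "q \<in> \<Union>C"
      then obtain F where "F \<in> C" "p \<in> F" "q \<in> F"
        using chain by blast
      then show "meet L p q \<in> \<Union>C"
        using mem(1) by (auto simp: is_filter_def)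
    next
      fix p q assume "p \<in> \<Union>C" "q \<in> carrier L" "ble L p q"
      then show "q \<in> \<Union>C"
        using mem(1) unfolding is_filter_def by blast
    qed
    moreover have "boolalg.bot L \<notin> \<Union>C"
      using mem(2) by blast
    moreover have "K \<subseteq> \<Union>C"
      using mem(3) C(1) by blast
    ultimately show "\<Union>C \<in> P"
      by (simp add: P_def)
  qed
  then obtain M where M: "M \<in> P" "\<And>F. F \<in> P \<Longrightarrow> M \<subseteq> F \<Longrightarrow> F = M"
    by blast
  have "consistent L M"
    using M(1) filter_proper_iff unfolding consistent_def P_def by blast
  \<comment> \<open>Every consistent set lies in a proper filter, so maximality among proper filters
    gives maximality among consistent sets.\<close>
  moreover have "K' = M" if "consistent L K'" "M \<subseteq> K'" for K'
  proof -
    obtain F where F: "is_filter L F" "F \<noteq> carrier L" "K' \<subseteq> F"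
      using \<open>consistent L K'\<close> unfolding consistent_def by blast
    then have "F \<in> P"
      using filter_proper_iff M(1) \<open>M \<subseteq> K'\<close> by (auto simp: P_def)
    then show ?thesis
      using M(2) F(3) \<open>M \<subseteq> K'\<close> by blast
  qed
  ultimately show ?thesis
    using M(1) unfolding ultrafilter_def P_def by blast
qed

end

section \<open>Ultrafilters of a Boolean algebra\<close>

locale bool_ultrafilter = bool_algebra +
  fixes I
  assumes ultra: "ultrafilter L I"
begin

text \<open>Ultrafilters are defined as maximal consistent sets. A proper filter around
  \<open>I\<close> is itself consistent, so maximality makes it equal to \<open>I\<close>.\<close>

lemma is_filter: "is_filter L I" and bot_notin: "boolalg.bot L \<notin> I"
proof -
  obtain F where F: "is_filter L F" "F \<noteq> carrier L" "I \<subseteq> F"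
    using ultra unfolding ultrafilter_def consistent_def by blast
  then have "consistent L F"
    unfolding consistent_def by blast
  then have "F = I"
    using ultra F(3) unfolding ultrafilter_def by blast
  then show "is_filter L I" "boolalg.bot L \<notin> I"
    using F filter_proper_iff by auto
qed

lemma sub_carrier: "p \<in> I \<Longrightarrow> p \<in> carrier L"
  using is_filter unfolding is_filter_def by blast

lemma up_closed: "\<lbrakk>p \<in> I; q \<in> carrier L; ble L p q\<rbrakk> \<Longrightarrow> q \<in> I"
  using is_filter unfolding is_filter_def by blast

lemma meet_in_iff:
  "\<lbrakk>p \<in> carrier L; q \<in> carrier L\<rbrakk> \<Longrightarrow> meet L p q \<in> I \<longleftrightarrow> p \<in> I \<and> q \<in> I"
  using is_filter meet_ble1 meet_ble2 up_closed unfolding is_filter_def by blast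

text \<open>The filter \<open>G\<close> generated by \<open>I\<close> and \<open>p\<close> properly
  extends \<open>I\<close> and therefore contains 0. Hence some member of \<open>I\<close> is
  disjoint from \<open>p\<close>, and it lies below the complement of \<open>p\<close>.\<close>

lemma neg_in_if_notin:
  assumes p: "p \<in> carrier L" "p \<notin> I"
  shows "neg L p \<in> I"
proof -
  define G where "G = {q \<in> carrier L. \<exists>i\<in>I. ble L (meet L i p) q}"
  have le: "ble L (meet L (meet L i j) p) (meet L i p)" "ble L (meet L (meet L i j) p) (meet L j p)"
    if "i \<in> I" "j \<in> I" for i j
  proof -
    have "ble L (meet L (meet L i j) p) i" "ble L (meet L (meet L i j) p) j"
      "ble L (meet L (meet L i j) p) p"
      using that p sub_carrier by (meson ble_trans meet_ble1 meet_ble2 meet_closed)+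
    then show "ble L (meet L (meet L i j) p) (meet L i p)"
      "ble L (meet L (meet L i j) p) (meet L j p)"
      using that p sub_carrier by (auto intro!: ble_meetI meet_closed)
  qed
  have "is_filter L G"
    unfolding is_filter_def
  proof (intro conjI ballI impI)
    show "G \<subseteq> carrier L"
      by (auto simp: G_def)
    have "p \<in> G"
      using p(1) filter_top[OF is_filter] meet_ble2 top_closed by (auto simp: G_def)
    then show "G \<noteq> {}"
      by blast
  next
    fix q r assume "q \<in> G" "r \<in> G"
    then obtain i j where ij: "i \<in> I" "j \<in> I" "ble L (meet L i p) q" "ble L (meet L j p) r"
      and qr: "q \<in> carrier L" "r \<in> carrier L"
      by (auto simp: G_def)
    have "meet L i j \<in> I"
      using ij sub_carrier meet_in_iff by blast
    moreover have "ble L (meet L (meet L i j) p) (meet L q r)"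
    proof -
      have c: "meet L (meet L i j) p \<in> carrier L" "meet L i p \<in> carrier L" "meet L j p \<in> carrier L"
        using ij p sub_carrier meet_closed by auto
      show ?thesis
        using ble_meetI[OF qr c(1)] ble_trans[OF c(1,2) qr(1) le(1) ij(3)]
          ble_trans[OF c(1,3) qr(2) le(2) ij(4)] ij(1,2) by blast
    qed
    ultimately show "meet L q r \<in> G"
      using qr by (auto simp: G_def meet_closed)
  next
    fix q r assume "q \<in> G" "r \<in> carrier L" "ble L q r"
    then show "r \<in> G"
      using p sub_carrier unfolding G_def by (blast intro: ble_trans meet_closed)
  qed
  moreover have "I \<subseteq> G"
    using p sub_carrier meet_ble1 by (auto simp: G_def)
  moreover have "p \<in> G"
    using p(1) filter_top[OF is_filter] meet_ble2 top_closed by (auto simp: G_def)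
  ultimately have "\<not> consistent L G"
    using ultra p(2) unfolding ultrafilter_def by blast
  then have "boolalg.bot L \<in> G"
    using \<open>is_filter L G\<close> filter_proper_iff unfolding consistent_def by blast
  then obtain i where "i \<in> I" "meet L i p = boolalg.bot L"
    using p sub_carrier ble_bot meet_closed unfolding G_def by blast
  then show ?thesis
    using p sub_carrier ble_neg_if_disjoint neg_closed up_closed by blast
qed

lemma neg_in_iff: "p \<in> carrier L \<Longrightarrow> neg L p \<in> I \<longleftrightarrow> p \<notin> I"
  using neg_in_if_notin meet_in_iff[of p "neg L p"] bot_notin meet_neg neg_closed by auto

lemma join_in_iff:
  assumes "p \<in> carrier L" "q \<in> carrier L"
  shows "join L p q \<in> I \<longleftrightarrow> p \<in> I \<or> q \<in> I"
proof
  assume j: "join L p q \<in> I"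
  show "p \<in> I \<or> q \<in> I"
  proof (rule ccontr)
    assume "\<not> (p \<in> I \<or> q \<in> I)"
    then have np: "neg L p \<in> I" and nq: "neg L q \<in> I"
      using assms neg_in_iff by auto
    have "meet L (neg L p) (join L p q) \<in> I"
      using np j meet_in_iff sub_carrier by blast
    moreover have "ble L (meet L (neg L p) (join L p q)) q"
    proof -
      have "meet L (neg L p) (join L p q)
          = join L (meet L (neg L p) p) (meet L (neg L p) q)"
        using assms by (simp add: meet_join_distrib neg_closed)
      also have "meet L (neg L p) p = boolalg.bot L"
        using assms meet_comm[of "neg L p" p] by (simp add: meet_neg neg_closed)
      finally show ?thesis
        using assms bot_ble by (simp add: join_bleI meet_ble2 bool_closed)
    qed
    ultimately have "q \<in> I"
      using assms(2) up_closed by blast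
    then show False
      using nq assms neg_in_iff by blast
  qed
next
  assume "p \<in> I \<or> q \<in> I"
  then show "join L p q \<in> I"
    using up_closed[OF _ join_closed ble_join1] up_closed[OF _ join_closed ble_join2] assms by blast
qed

lemma top_in: "boolalg.top L \<in> I"
  using filter_top is_filter by blast

end

lemma bool_hom_comp:
  "\<lbrakk>bool_hom L M f; bool_hom M N g\<rbrakk> \<Longrightarrow> bool_hom L N (\<lambda>p. g (f p))"
  unfolding bool_hom_def by (simp add: Pi_iff)

lemma bool_hom_mono:
  "\<lbrakk>bool_hom L M h; p \<in> carrier L; q \<in> carrier L; ble L p q\<rbrakk> \<Longrightarrow> ble M (h p) (h q)"
  unfolding bool_hom_def ble_def by metis

section \<open>The quotient by an ultrafilter\<close>

locale small_bool_ultrafilter = bool_ultrafilter L I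
  for L :: "'v::set_universe boolalg" and I +
  assumes small_carrier: "small (carrier L)"
begin

abbreviation "Q \<equiv> quotient_algebra L I"
abbreviation "cls \<equiv> quot_class L I"

text \<open>Modulo an ultrafilter, the biconditional of two elements lies in \<open>I\<close>
  exactly when both or neither of them do. Questions about classes thus become questions of
  membership in \<open>I\<close>.\<close>

lemma elts_cls: "p \<in> carrier L \<Longrightarrow> elts (cls p) = {q \<in> carrier L. q \<in> I \<longleftrightarrow> p \<in> I}"
  unfolding quot_class_def
  by (subst elts_set_of) (auto intro: small_subset[OF small_carrier]
      simp: meet_in_iff join_in_iff neg_in_iff bool_closed)

lemma cls_eq_iff:
  assumes "p \<in> carrier L" "q \<in> carrier L"
  shows "cls p = cls q \<longleftrightarrow> (p \<in> I \<longleftrightarrow> q \<in> I)"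
proof
  assume "cls p = cls q"
  then have "p \<in> elts (cls q)"
    using elts_cls[OF assms(1)] assms(1) by auto
  then show "p \<in> I \<longleftrightarrow> q \<in> I"
    using elts_cls[OF assms(2)] by auto
next
  assume "p \<in> I \<longleftrightarrow> q \<in> I"
  then have "elts (cls p) = elts (cls q)"
    using assms by (simp add: elts_cls)
  then show "cls p = cls q"
    by (rule extensionality)
qed

lemma quot_rep_cls:
  assumes "p \<in> carrier L"
  shows "quot_rep (cls p) \<in> carrier L" "quot_rep (cls p) \<in> I \<longleftrightarrow> p \<in> I"
proof -
  have "quot_rep (cls p) \<in> elts (cls p)"
    unfolding quot_rep_def by (rule someI[of _ p]) (simp add: elts_cls assms)
  then show "quot_rep (cls p) \<in> carrier L" "quot_rep (cls p) \<in> I \<longleftrightarrow> p \<in> I"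
    by (simp_all add: elts_cls assms)
qed

text \<open>The operations compute with arbitrarily chosen representatives. They are well defined
  because membership of a meet, join or complement in \<open>I\<close> depends only on the
  memberships of its arguments.\<close>

lemma quotient_simps:
  "carrier Q = cls ` carrier L"
  "boolalg.bot Q = cls (boolalg.bot L)"
  "boolalg.top Q = cls (boolalg.top L)"
  "\<lbrakk>p \<in> carrier L; q \<in> carrier L\<rbrakk> \<Longrightarrow> meet Q (cls p) (cls q) = cls (meet L p q)"
  "\<lbrakk>p \<in> carrier L; q \<in> carrier L\<rbrakk> \<Longrightarrow> join Q (cls p) (cls q) = cls (join L p q)"
  "p \<in> carrier L \<Longrightarrow> neg Q (cls p) = cls (neg L p)"
  by (simp_all add: quotient_algebra_def cls_eq_iff quot_rep_cls bool_closed
      meet_in_iff join_in_iff neg_in_iff)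

lemma quotient_bool_algebra: "bool_algebra Q"
  by unfold_locales
    (auto simp: quotient_simps cls_eq_iff bool_closed meet_in_iff join_in_iff neg_in_iff
      bot_notin top_in)

lemma quotient_hom: "bool_hom L Q cls"
  unfolding bool_hom_def by (simp add: quotient_simps)

lemma quotient_two: "carrier Q = {boolalg.bot Q, boolalg.top Q}"
  using bot_closed top_closed bot_notin top_in
  by (auto simp: quotient_simps cls_eq_iff)

lemma quotient_nontrivial: "boolalg.bot Q \<noteq> boolalg.top Q"
  by (simp add: quotient_simps cls_eq_iff bot_closed top_closed bot_notin top_in)

lemma quotient_ble_iff:
  "\<lbrakk>p \<in> carrier L; q \<in> carrier L\<rbrakk> \<Longrightarrow> ble Q (cls p) (cls q) \<longleftrightarrow> (p \<in> I \<longrightarrow> q \<in> I)"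
  unfolding ble_def by (auto simp: quotient_simps cls_eq_iff meet_in_iff bool_closed)

text \<open>The quotient has only the values 0 and 1, and its order is implication between
  memberships in \<open>I\<close>; an infimum is therefore 1 exactly when every member is 1.\<close>

lemma quotient_infimumI:
  assumes "m \<in> carrier L" "P \<subseteq> carrier L" "m \<in> I \<longleftrightarrow> P \<subseteq> I"
  shows "is_infimum Q (cls ` P) (cls m)"
proof -
  have "ble Q (cls l) (cls p) \<longleftrightarrow> (l \<in> I \<longrightarrow> p \<in> I)" if "l \<in> carrier L" "p \<in> insert m P" for l p
    using that assms(1,2) quotient_ble_iff by blast
  then show ?thesis
    using assms unfolding is_infimum_def by (auto simp: quotient_simps)
qed

end


section \<open>Substitutions\<close>

lemma PiE_upd: "\<lbrakk>\<sigma> \<in> X \<rightarrow>\<^sub>E T; x \<in> X; d \<in> T\<rbrakk> \<Longrightarrow> \<sigma>(x := d) \<in> X \<rightarrow>\<^sub>E T"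
  by (auto simp: PiE_iff extensional_def)

context quantifier_theory
begin

lemma var_in: "\<lbrakk>X \<in> S; x \<in> X\<rbrakk> \<Longrightarrow> var A X x \<in> terms A X"
  using var_closed by blast

lemma incl_in: "\<lbrakk>X \<in> S; U \<subseteq> X\<rbrakk> \<Longrightarrow> incl A U X \<in> U \<rightarrow>\<^sub>E terms A X"
  unfolding incl_def using var_in by auto

lemma single_in: "\<lbrakk>Y \<in> S; y \<in> Y; d \<in> terms A Y\<rbrakk> \<Longrightarrow> single A Y d y \<in> Y \<rightarrow>\<^sub>E terms A Y"
  unfolding single_def by (intro PiE_upd incl_in) auto

lemma single_same: "single A Y d y y = d"
  by (simp add: single_def)

lemma single_other: "\<lbrakk>u \<in> Y; u \<noteq> y\<rbrakk> \<Longrightarrow> single A Y d y u = var A Y u"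
  by (simp add: single_def incl_def)

lemma scomp_incl:
  assumes "X \<in> S" "Y \<in> S" "U \<subseteq> X" "\<tau> \<in> X \<rightarrow>\<^sub>E terms A Y"
  shows "scomp A U X Y (incl A U X) \<tau> = restrict \<tau> U"
  unfolding scomp_def using assms by (auto simp: incl_def P3 intro!: restrict_ext)

lemma fsub_incl_sub:
  assumes "U \<in> S" "U \<noteq> {}" "X \<in> S" "Y \<in> S" "U \<subseteq> X" "p \<in> fcarrier A U" "\<tau> \<in> X \<rightarrow>\<^sub>E terms A Y"
  shows "fsub A X Y (fsub A U X p (incl A U X)) \<tau> = fsub A U Y p (restrict \<tau> U)"
  using assms by (subst P2_form) (auto simp: scomp_incl incl_in)

lemma tsub_single_var:
  "\<lbrakk>Y \<in> S; u \<in> Y; u \<noteq> y; y \<in> Y; d \<in> terms A Y\<rbrakk> \<Longrightarrow> tsub A Y Y (var A Y u) (single A Y d y) = var A Y u"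
  by (simp add: P3 single_in single_other)

lemma tsub_incl_fresh:
  "\<lbrakk>V \<subseteq> Y; Y \<in> S; y \<in> Y - V; e \<in> terms A Y; u \<in> V\<rbrakk>
    \<Longrightarrow> tsub A Y Y (incl A V Y u) (single A Y e y) = incl A V Y u"
  by (auto simp: incl_def intro!: tsub_single_var)

lemma scomp_single_eq:
  assumes "\<sigma> \<in> X \<rightarrow>\<^sub>E terms A Y" "\<forall>u\<in>X. tsub A Y Y (\<sigma> u) (single A Y d y) = \<sigma> u"
  shows "scomp A X Y Y \<sigma> (single A Y d y) = \<sigma>"
  using assms by (intro ext) (auto simp: scomp_def PiE_def extensional_def)

lemma scomp_upd_single:
  assumes "Y \<in> S" "\<sigma> \<in> X \<rightarrow>\<^sub>E terms A Y" "x \<in> X" "y \<in> Y" "d \<in> terms A Y"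
    and "\<forall>u\<in>X - {x}. tsub A Y Y (\<sigma> u) (single A Y d y) = \<sigma> u"
  shows "scomp A X Y Y (\<sigma>(x := var A Y y)) (single A Y d y) = \<sigma>(x := d)"
  using assms P3[of Y y Y "single A Y d y"] single_in[of Y y d]
  by (intro ext) (auto simp: scomp_def PiE_def extensional_def single_same)

text \<open>Non-occurrence of \<open>y\<close> in the values of \<sigma> is expressed by their
  invariance under \<open>[d/y]\<close>, as there is no syntax to inspect; (P2) transfers the
  invariance to the formula.\<close>

lemma fsub_single_eq:
  assumes "X \<in> S" "X \<noteq> {}" "Y \<in> S" "p \<in> fcarrier A X" "\<sigma> \<in> X \<rightarrow>\<^sub>E terms A Y" "y \<in> Y" "d \<in> terms A Y"
    and "\<forall>u\<in>X. tsub A Y Y (\<sigma> u) (single A Y d y) = \<sigma> u"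
  shows "fsub A Y Y (fsub A X Y p \<sigma>) (single A Y d y) = fsub A X Y p \<sigma>"
  using assms by (subst P2_form) (auto simp: single_in scomp_single_eq)

text \<open>This turns the instances of \<open>p\<close> along varying maps into single-variable
  substitutions in one formula over \<open>Y\<close>, the form of which perfectness speaks. By (P2)
  it reduces to a composition of maps.\<close>

lemma fsub_upd_single:
  assumes "X \<in> S" "Y \<in> S" "p \<in> fcarrier A X" "\<sigma> \<in> X \<rightarrow>\<^sub>E terms A Y" "x \<in> X" "y \<in> Y" "d \<in> terms A Y"
    and "\<forall>u\<in>X - {x}. tsub A Y Y (\<sigma> u) (single A Y d y) = \<sigma> u"
  shows "fsub A Y Y (fsub A X Y p (\<sigma>(x := var A Y y))) (single A Y d y) = fsub A X Y p (\<sigma>(x := d))"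
proof -
  have "\<sigma>(x := var A Y y) \<in> X \<rightarrow>\<^sub>E terms A Y"
    using assms by (intro PiE_upd var_in)
  then show ?thesis
    using assms by (subst P2_form) (auto simp: single_in scomp_upd_single)
qed

lemma fsub_all:
  assumes "X \<in> S" "x \<in> X" "Y \<in> S" "p \<in> fcarrier A X" "\<sigma> \<in> X \<rightarrow>\<^sub>E terms A Y" "y \<in> Y" "z \<in> Y" "y \<noteq> z"
    and "\<forall>u\<in>X. tsub A Y Y (\<sigma> u) (single A Y (var A Y z) y) = \<sigma> u"
  shows "fsub A X Y (all A X x p) \<sigma> = all A Y y (fsub A X Y p (\<sigma>(x := var A Y y)))"
  using assms by (intro P5) (auto intro: scomp_single_eq)

text \<open>The order is defined through meets, which the quantifier preserves by (Q1).\<close>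

lemma all_mono:
  assumes "X \<in> S" "x \<in> X" "p \<in> fcarrier A X" "q \<in> fcarrier A X" "ble (forms A X) p q"
  shows "ble (forms A X) (all A X x p) (all A X x q)"
  using assms Q1[of X x p q] unfolding ble_def by metis


section \<open>Henkin formulas\<close>

(* The first disjunct is the image of the quantified formula rather than the quantified image:
   then it is fixed by every substitution moving only variables outside V. *)
definition henkin :: "'v set \<Rightarrow> 'v set \<Rightarrow> 'v \<Rightarrow> 'v \<Rightarrow> 'v \<Rightarrow> 'v" where
  "henkin V Y z q d = join (forms A Y) (fsub A V Y (all A V z q) (incl A V Y))
     (neg (forms A Y) (fsub A V Y q ((incl A V Y)(z := var A Y d))))"

context
  fixes V Y z q d
  assumes V: "V \<in> S" and Y: "Y \<in> S" and VY: "V \<subseteq> Y" and z: "z \<in> V" and q: "q \<in> fcarrier A V"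
    and d: "d \<in> Y - V"
begin

interpretation Y: bool_algebra "forms A Y"
  using Y by (rule forms_algebra)

lemma incl_upd_in: "y \<in> Y \<Longrightarrow> (incl A V Y)(z := var A Y y) \<in> V \<rightarrow>\<^sub>E terms A Y"
  using V Y VY z by (intro PiE_upd incl_in var_in) auto

lemma henkin_parts_in:
  "fsub A V Y (all A V z q) (incl A V Y) \<in> fcarrier A Y"
  "y \<in> Y \<Longrightarrow> fsub A V Y q ((incl A V Y)(z := var A Y y)) \<in> fcarrier A Y"
  using V Y VY z q d incl_upd_in by (auto intro!: fsub_closed all_closed incl_in)

lemma henkin_in: "henkin V Y z q d \<in> fcarrier A Y"
  unfolding henkin_def using henkin_parts_in d by (auto intro!: Y.bool_closed)

text \<open>This is (P5) for the inclusion map, with \<open>z\<close> itself as the auxiliary second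
  variable: \<open>[z/y]\<close> fixes the variables of \<open>V\<close> because \<open>y\<close>
  lies outside \<open>V\<close>.\<close>

lemma all_fresh:
  assumes "y \<in> Y - V"
  shows "fsub A V Y (all A V z q) (incl A V Y) = all A Y y (fsub A V Y q ((incl A V Y)(z := var A Y y)))"
  using V Y VY z q assms tsub_incl_fresh[OF VY Y assms] var_in[of Y z]
  by (intro fsub_all[where z = z] incl_in) auto

text \<open>Outside \<open>V\<close> the axiom involves only \<open>d\<close>. Adjoining it to a
  formula therefore leaves all other fresh variables fresh.\<close>

lemma henkin_fresh:
  assumes "y \<in> Y - V" "y \<noteq> d" "w \<in> Y"
  shows "fsub A Y Y (henkin V Y z q d) (single A Y (var A Y w) y) = henkin V Y z q d"
proof -
  let ?s = "single A Y (var A Y w) y"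
  have hom: "bool_hom (forms A Y) (forms A Y) (\<lambda>p. fsub A Y Y p ?s)"
    using Y assms by (intro P4 single_in var_in) auto
  have "fsub A Y Y (fsub A V Y (all A V z q) (incl A V Y)) ?s = fsub A V Y (all A V z q) (incl A V Y)"
    using V Y VY z q assms tsub_incl_fresh[OF VY Y, of y "var A Y w"]
    by (intro fsub_single_eq all_closed incl_in) (auto intro: var_in)
  moreover have "fsub A Y Y (fsub A V Y q ((incl A V Y)(z := var A Y d))) ?s
      = fsub A V Y q ((incl A V Y)(z := var A Y d))"
    using V Y VY z q d assms tsub_incl_fresh[OF VY Y, of y "var A Y w"] incl_upd_in[of d]
      tsub_single_var[OF Y, of d y "var A Y w"]
    by (intro fsub_single_eq) (auto intro: var_in)
  ultimately show ?thesis
    using hom henkin_parts_in d unfolding henkin_def bool_hom_def by (simp add: Y.neg_closed)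
qed

lemma henkin_consistent:
  assumes c: "c \<in> fcarrier A Y" "c \<noteq> boolalg.bot (forms A Y)"
    and w: "w \<in> V" and fresh: "fsub A Y Y c (single A Y (var A Y w) d) = c"
  shows "meet (forms A Y) c (henkin V Y z q d) \<noteq> boolalg.bot (forms A Y)"
proof
  assume bot: "meet (forms A Y) c (henkin V Y z q d) = boolalg.bot (forms A Y)"
  define a where "a = fsub A V Y (all A V z q) (incl A V Y)"
  define b where "b = fsub A V Y q ((incl A V Y)(z := var A Y d))"
  have ab: "a \<in> fcarrier A Y" "b \<in> fcarrier A Y"
    using henkin_parts_in d by (auto simp: a_def b_def)
  have a_all: "a = all A Y d b"
    unfolding a_def b_def by (rule all_fresh[OF d])
  \<comment> \<open>Whatever lies below the Henkin axiom is disjoint from \<open>c\<close>; this is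
    applied to each of the two disjuncts.\<close>
  have zero: "meet (forms A Y) c e = boolalg.bot (forms A Y)"
    if "e \<in> fcarrier A Y" "ble (forms A Y) e (join (forms A Y) a (neg (forms A Y) b))" for e
  proof -
    have "meet (forms A Y) c e \<in> fcarrier A Y" "ble (forms A Y) (meet (forms A Y) c e) c"
      "ble (forms A Y) (meet (forms A Y) c e) (join (forms A Y) a (neg (forms A Y) b))"
      using c that ab Y.ble_trans[OF _ _ _ Y.meet_ble2] by (auto simp: Y.bool_closed Y.meet_ble1)
    then have "ble (forms A Y) (meet (forms A Y) c e) (boolalg.bot (forms A Y))"
      using bot c ab Y.ble_meetI[of c "join (forms A Y) a (neg (forms A Y) b)" "meet (forms A Y) c e"]
      by (auto simp: henkin_def a_def b_def Y.bool_closed)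
    then show ?thesis
      using \<open>meet (forms A Y) c e \<in> _\<close> by (rule Y.ble_bot[rotated])
  qed
  have ca: "meet (forms A Y) c a = boolalg.bot (forms A Y)"
    using zero ab by (simp add: Y.ble_join1 Y.neg_closed)
  have "meet (forms A Y) c (neg (forms A Y) b) = boolalg.bot (forms A Y)"
    using zero ab by (simp add: Y.ble_join2 Y.neg_closed)
  then have "ble (forms A Y) c b"
    using c ab by (intro Y.ble_if_disjoint_neg)
  then have "ble (forms A Y) (all A Y d c) (all A Y d b)"
    using Y d c ab by (intro all_mono) auto
  \<comment> \<open>The variable \<open>w\<close> belongs to \<open>V\<close> and \<open>d\<close>
    does not, so they differ, and invariance of \<open>c\<close> under \<open>[w/d]\<close> is the
    premise of (Q3).\<close>
  moreover have "all A Y d c = c"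
    using Y d c w VY fresh by (intro Q3[where y = w]) auto
  ultimately have "ble (forms A Y) c a"
    using a_all by simp
  then show False
    using ca c by (simp add: ble_def)
qed

text \<open>The axiom carries the image of the quantified formula, whereas perfectness quantifies
  the image \<open>p\<close>. The former is below \<open>p\<close> by (Q2) and does not depend on
  \<open>z\<close>, so monotonicity of the quantifier puts it below the latter.\<close>

lemma henkin_witness:
  assumes w: "w \<in> V" "w \<noteq> z"
  defines "p \<equiv> fsub A V Y q (incl A V Y)"
  shows "ble (forms A Y) (henkin V Y z q d)
    (join (forms A Y) (all A Y z p) (neg (forms A Y) (fsub A Y Y p (single A Y (var A Y d) z))))"
proof -
  let ?k = "incl A V Y"
  define a where "a = fsub A V Y (all A V z q) ?k"
  have zY: "z \<in> Y" and dY: "d \<in> Y" and wY: "w \<in> Y"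
    using z VY d w by auto
  have s: "single A Y (var A Y e) z \<in> Y \<rightarrow>\<^sub>E terms A Y" if "e \<in> Y" for e
    using Y zY that by (intro single_in var_in)
  have restrict: "restrict (single A Y (var A Y e) z) V = ?k(z := var A Y e)" for e
    using z VY by (auto simp: fun_eq_iff single_def incl_def restrict_def)
  have p: "p \<in> fcarrier A Y" and a: "a \<in> fcarrier A Y" and kE: "?k \<in> V \<rightarrow>\<^sub>E terms A Y"
    using V Y VY z q by (auto simp: p_def a_def intro!: fsub_closed incl_in all_closed)
  have pd: "fsub A Y Y p (single A Y (var A Y d) z) = fsub A V Y q (?k(z := var A Y d))"
    unfolding p_def using V Y VY z q s[OF dY] restrict by (subst fsub_incl_sub) auto
  have "bool_hom (forms A V) (forms A Y) (\<lambda>p. fsub A V Y p ?k)"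
    using V Y z kE by (intro P4) auto
  then have "ble (forms A Y) a p"
    unfolding a_def p_def using V z q by (auto intro: bool_hom_mono all_closed Q2)
  then have "ble (forms A Y) (all A Y z a) (all A Y z p)"
    using Y zY a p by (intro all_mono)
  \<comment> \<open>Independence of \<open>z\<close>: by (Q3) it suffices that \<open>a\<close> is
    unchanged when \<open>w\<close> replaces \<open>z\<close>.\<close>
  moreover have "all A Y z a = a"
  proof -
    have "fsub A Y Y a (single A Y (var A Y w) z) = fsub A V Y (all A V z q) (?k(z := var A Y w))"
      unfolding a_def using V Y VY z q s[OF wY] restrict all_closed by (subst fsub_incl_sub) auto
    \<comment> \<open>In (P5) with bound variable \<open>d\<close>, the update of \<open>z\<close>
      to \<open>d\<close> overrides the update to \<open>w\<close>; what remains is the formula of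
      \<open>all_fresh\<close>.\<close>
    also have "\<dots> = all A Y d (fsub A V Y q ((?k(z := var A Y w))(z := var A Y d)))"
    proof -
      have "tsub A Y Y ((?k(z := var A Y w)) u) (single A Y (var A Y z) d) = (?k(z := var A Y w)) u"
        if "u \<in> V" for u
        using that d w wY tsub_incl_fresh[OF VY Y d var_in[OF Y zY]]
          tsub_single_var[OF Y wY _ dY var_in[OF Y zY]] by auto
      then show ?thesis
        using V Y VY z q d incl_upd_in[OF wY] by (intro fsub_all[where z = z]) auto
    qed
    also have "\<dots> = a"
      unfolding a_def using all_fresh[OF d] by simp
    finally show ?thesis
      using Y zY a wY w by (intro Q3[where y = w]) auto
  qed
  ultimately have "ble (forms A Y) a (all A Y z p)"
    by simp
  then show ?thesis
    unfolding henkin_def pd a_def[symmetric] using a p henkin_parts_in(2)[of d] Y zY dY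
    by (intro Y.join_mono1) (auto intro: Y.bool_closed all_closed)
qed

end

end


section \<open>Existence of perfect ultrafilters\<close>

context quantifier_theory
begin

text \<open>Each stage adjoins one fresh variable per pair of a variable and a formula, and stays
  small because the set of formulas is small. The step is iterated since the enlarged set carries
  new formulas, which need witnesses of their own.\<close>

lemma ex_henkin_tower:
  assumes S: "S = {V. small V}" and X: "X \<in> S"
  obtains Xs d where "Xs 0 = X" "\<And>n. Xs n \<in> S" "\<And>n. Xs n \<subseteq> Xs (Suc n)"
    "\<And>n::nat. inj_on (d n) (Xs n \<times> fcarrier A (Xs n))"
    "\<And>n. d n ` (Xs n \<times> fcarrier A (Xs n)) \<subseteq> Xs (Suc n) - Xs n"
proof -
  define \<phi> where "\<phi> V = (SOME f. inj_on f (V \<times> fcarrier A V) \<and> f ` (V \<times> fcarrier A V) \<inter> V = {})"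
    for V
  define Xs where "Xs = rec_nat X (\<lambda>_ V. V \<union> \<phi> V ` (V \<times> fcarrier A V))"
  have Xs_simps: "Xs 0 = X" "Xs (Suc n) = Xs n \<union> \<phi> (Xs n) ` (Xs n \<times> fcarrier A (Xs n))" for n
    by (simp_all add: Xs_def)
  have small: "Xs n \<in> S" for n
  proof (induction n)
    case (Suc n)
    then show ?case
      using S forms_small[OF Suc] by (auto simp: Xs_simps intro!: small_Un small_image_Times)
  qed (simp add: Xs_simps X)
  have \<phi>: "inj_on (\<phi> V) (V \<times> fcarrier A V)" "\<phi> V ` (V \<times> fcarrier A V) \<inter> V = {}" if "V \<in> S" for V
    using someI_ex[OF fresh_inj_Times[of V V "fcarrier A V"]] that S forms_small[OF that]
    by (auto simp: \<phi>_def)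
  have "\<phi> (Xs n) ` (Xs n \<times> fcarrier A (Xs n)) \<subseteq> Xs (Suc n) - Xs n" for n
    unfolding Xs_simps using \<phi>(2)[OF small[of n]] by blast
  then show ?thesis
    using small \<phi>(1)[OF small]
    by (intro that[of Xs "\<lambda>n. \<phi> (Xs n)"]) (auto simp: Xs_simps)
qed

section \<open>Henkin axioms over the limit of a tower\<close>

context
  fixes Xs :: "nat \<Rightarrow> 'v set" and d Y w F
  assumes S: "S = {V. small V}"
    and Xs: "Xs n \<in> S" and Xs_Suc: "Xs n \<subseteq> Xs (Suc n)"
    and d_inj: "inj_on (d n) (Xs n \<times> fcarrier A (Xs n))"
    and d_fresh: "d n ` (Xs n \<times> fcarrier A (Xs n)) \<subseteq> Xs (Suc n) - Xs n"
    and Y_def: "Y = (\<Union>n. Xs n)"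
    and w: "w \<in> Xs 0"
    and F: "is_filter (forms A (Xs 0)) F" "boolalg.bot (forms A (Xs 0)) \<notin> F"
begin

lemma tower_limit_in: "Y \<in> S"
  using small_UN_nat[of Xs] Xs S by (simp add: Y_def)

lemma stage_subset: "Xs n \<subseteq> Y"
  by (auto simp: Y_def)

lemma stage_mono: "m \<le> n \<Longrightarrow> Xs m \<subseteq> Xs n"
  using lift_Suc_mono_le[of Xs] Xs_Suc by blast

interpretation Y: bool_algebra "forms A Y"
  using tower_limit_in by (rule forms_algebra)

text \<open>The level is part of the index: the formula sets of different stages may overlap, and
  the axiom of a pair depends on the stage at which the pair is read.\<close>

definition axioms_index :: "(nat \<times> 'v \<times> 'v) set" where
  "axioms_index = {(n, z, q). z \<in> Xs n \<and> q \<in> fcarrier A (Xs n)}"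

definition axiom :: "nat \<times> 'v \<times> 'v \<Rightarrow> 'v" where
  "axiom = (\<lambda>(n, z, q). henkin (Xs n) Y z q (d n (z, q)))"

lemma index_fresh:
  assumes "(n, z, q) \<in> axioms_index"
  shows "d n (z, q) \<in> Y - Xs n"
proof -
  have "(z, q) \<in> Xs n \<times> fcarrier A (Xs n)"
    using assms by (auto simp: axioms_index_def)
  then have "d n (z, q) \<in> Xs (Suc n) - Xs n"
    using d_fresh by blast
  then show ?thesis
    using stage_subset[of "Suc n"] by blast
qed

text \<open>Within one level this is injectivity of \<open>d n\<close>. A variable from a lower
  level already belongs to \<open>Xs n\<close>, which the values of \<open>d n\<close>
  avoid.\<close>

lemma index_distinct:
  assumes "(n, z, q) \<in> axioms_index" "(m, z', q') \<in> axioms_index" "m \<le> n" "(m, z', q') \<noteq> (n, z, q)"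
  shows "d n (z, q) \<noteq> d m (z', q')"
proof (cases "m = n")
  case True
  have "(z, q) \<in> Xs n \<times> fcarrier A (Xs n)" "(z', q') \<in> Xs n \<times> fcarrier A (Xs n)"
    using assms True by (auto simp: axioms_index_def)
  then show ?thesis
    using True assms(4) inj_onD[OF d_inj] by blast
next
  case False
  have "(z', q') \<in> Xs m \<times> fcarrier A (Xs m)"
    using assms by (auto simp: axioms_index_def)
  then have "d m (z', q') \<in> Xs (Suc m)"
    using d_fresh by blast
  also have "Xs (Suc m) \<subseteq> Xs n"
    using False assms(3) by (intro stage_mono) simp
  finally show ?thesis
    using index_fresh[OF assms(1)] by auto
qed

lemma axiom_in: "t \<in> axioms_index \<Longrightarrow> axiom t \<in> fcarrier A Y"
  using henkin_in[OF Xs tower_limit_in stage_subset] index_fresh by (force simp: axiom_def axioms_index_def)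

text \<open>The map \<rho> sends all new variables to \<open>w\<close> and is a left inverse of the
  inclusion. Since substitution along it preserves 0, a vanishing image would make \<open>r\<close>
  itself 0.\<close>

lemma incl_Y_ne_bot:
  assumes "r \<in> F"
  shows "fsub A (Xs 0) Y r (incl A (Xs 0) Y) \<noteq> boolalg.bot (forms A Y)"
proof
  assume bot: "fsub A (Xs 0) Y r (incl A (Xs 0) Y) = boolalg.bot (forms A Y)"
  define \<rho> where "\<rho> = (\<lambda>y\<in>Y. var A (Xs 0) (if y \<in> Xs 0 then y else w))"
  have r: "r \<in> fcarrier A (Xs 0)"
    using F(1) assms by (auto simp: is_filter_def)
  have ne: "Xs 0 \<noteq> {}" "Y \<noteq> {}"
    using w stage_subset by auto
  have \<rho>: "\<rho> \<in> Y \<rightarrow>\<^sub>E terms A (Xs 0)"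
    using w Xs by (auto simp: \<rho>_def intro!: var_in)
  have "restrict \<rho> (Xs 0) = incl A (Xs 0) (Xs 0)"
    using stage_subset by (auto simp: \<rho>_def incl_def fun_eq_iff restrict_def)
  then have "fsub A Y (Xs 0) (fsub A (Xs 0) Y r (incl A (Xs 0) Y)) \<rho> = r"
    using fsub_incl_sub[OF Xs ne(1) tower_limit_in Xs stage_subset r \<rho>] Xs ne r by (simp add: P1_form)
  moreover have "fsub A Y (Xs 0) (boolalg.bot (forms A Y)) \<rho> = boolalg.bot (forms A (Xs 0))"
    using P4[OF tower_limit_in ne(2) Xs \<rho>] by (auto simp: bool_hom_def)
  ultimately show False
    using bot F(2) assms by simp
qed

text \<open>A sufficient condition for \<open>y\<close> to occur neither in images of formulas over
  \<open>Xs 0\<close> nor in the axioms indexed by \<open>E\<close>: the axiom of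
  \<open>(n, z, q)\<close> involves only variables of \<open>Xs n\<close> and its witness.\<close>

definition fresh_for :: "(nat \<times> 'v \<times> 'v) set \<Rightarrow> 'v \<Rightarrow> bool" where
  "fresh_for E y \<longleftrightarrow> y \<in> Y \<and> y \<notin> Xs 0 \<and> (\<forall>(n, z, q)\<in>E. y \<notin> Xs n \<and> y \<noteq> d n (z, q))"

(* Adding the Henkin axioms in order of increasing level, the variable introduced by the last one
   does not occur in the others. *)
lemma ex_lower_bound:
  assumes r: "r \<in> F" and "finite E"
  shows "E \<subseteq> axioms_index \<Longrightarrow> \<exists>c\<in>fcarrier A Y. c \<noteq> boolalg.bot (forms A Y) \<and>
    ble (forms A Y) c (fsub A (Xs 0) Y r (incl A (Xs 0) Y)) \<and> (\<forall>t\<in>E. ble (forms A Y) c (axiom t)) \<and>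
    (\<forall>y. fresh_for E y \<longrightarrow> fsub A Y Y c (single A Y (var A Y w) y) = c)"
  using assms(2)
proof (induction E rule: finite_ranking_induct[where f = fst])
  case empty
  have "r \<in> fcarrier A (Xs 0)"
    using F(1) r by (auto simp: is_filter_def)
  then have "fsub A (Xs 0) Y r (incl A (Xs 0) Y) \<in> fcarrier A Y"
    "fresh_for {} y \<Longrightarrow> fsub A Y Y (fsub A (Xs 0) Y r (incl A (Xs 0) Y)) (single A Y (var A Y w) y)
      = fsub A (Xs 0) Y r (incl A (Xs 0) Y)" for y
    using w Xs tower_limit_in stage_subset[of 0]
      tsub_incl_fresh[OF stage_subset tower_limit_in, of y 0 "var A Y w"]
    by (auto simp: fresh_for_def intro!: fsub_closed incl_in fsub_single_eq var_in)
  then show ?case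
    using incl_Y_ne_bot[OF r] Y.ble_refl by blast
next
  case (insert t E)
  show ?case
  \<comment> \<open>The ranking induction admits a \<open>t\<close> that is already in
    \<open>E\<close>; the witness of \<open>t\<close> is fresh for \<open>E\<close> only in the
    other case.\<close>
  proof (cases "t \<in> E")
    case True
    then show ?thesis
      using insert by (simp add: insert_absorb)
  next
    case False
    obtain n z q where t: "t = (n, z, q)"
      by (cases t)
    have tI: "(n, z, q) \<in> axioms_index"
      using insert.prems t by simp
    then have zq: "z \<in> Xs n" "q \<in> fcarrier A (Xs n)"
      by (auto simp: axioms_index_def)
    obtain c where c: "c \<in> fcarrier A Y" "c \<noteq> boolalg.bot (forms A Y)"
      "ble (forms A Y) c (fsub A (Xs 0) Y r (incl A (Xs 0) Y))"
      "\<And>t. t \<in> E \<Longrightarrow> ble (forms A Y) c (axiom t)"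
      "\<And>y. fresh_for E y \<Longrightarrow> fsub A Y Y c (single A Y (var A Y w) y) = c"
      using insert.IH insert.prems by auto
    have h: "axiom t \<in> fcarrier A Y" and h_def: "axiom t = henkin (Xs n) Y z q (d n (z, q))"
      using axiom_in insert.prems by (auto simp: axiom_def t)
    have wn: "w \<in> Xs n" "w \<in> Y"
      using w stage_mono[of 0 n] stage_subset by auto
    \<comment> \<open>The witness avoids its own stage and all lower ones; as no level in
      \<open>E\<close> exceeds \<open>n\<close>, \<open>index_distinct\<close> separates it from the
      other witnesses. Hence \<open>c\<close> is fixed by \<open>[w/d]\<close>, as
      \<open>henkin_consistent\<close> demands.\<close>
    have "fresh_for E (d n (z, q))"
      unfolding fresh_for_def
    proof (intro conjI ballI)
      show "d n (z, q) \<in> Y" "d n (z, q) \<notin> Xs 0"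
        using index_fresh[OF tI] stage_mono[of 0 n] by auto
      fix e assume e: "e \<in> E"
      obtain m z' q' where e': "e = (m, z', q')"
        by (cases e)
      have "m \<le> n"
        using insert.hyps(2)[OF e] e' t by simp
      then show "case e of (m, z', q') \<Rightarrow> d n (z, q) \<notin> Xs m \<and> d n (z, q) \<noteq> d m (z', q')"
        using e e' t False insert.prems index_fresh[OF tI] stage_mono[of m n]
          index_distinct[OF tI, of m z' q'] by auto
    qed
    then have ne: "meet (forms A Y) c (axiom t) \<noteq> boolalg.bot (forms A Y)"
      unfolding h_def
      using henkin_consistent[OF Xs tower_limit_in stage_subset zq index_fresh[OF tI] c(1,2) wn(1)] c(5) by blast
    define c' where "c' = meet (forms A Y) c (axiom t)"
    have c': "c' \<in> fcarrier A Y"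
      using c(1) h by (simp add: c'_def Y.meet_closed)
    have le: "ble (forms A Y) c' e" if "e \<in> fcarrier A Y" "ble (forms A Y) c e" for e
      using that Y.ble_trans[OF c' c(1)] Y.meet_ble1[OF c(1) h] by (simp add: c'_def)
    have "r \<in> fcarrier A (Xs 0)"
      using F(1) r by (auto simp: is_filter_def)
    then have "ble (forms A Y) c' (fsub A (Xs 0) Y r (incl A (Xs 0) Y))"
      using w Xs tower_limit_in stage_subset c(3) by (intro le fsub_closed incl_in) auto
    moreover have "ble (forms A Y) c' (axiom e)" if "e \<in> insert t E" for e
    proof (cases "e = t")
      case True
      then show ?thesis
        using Y.meet_ble2[OF c(1) h] by (simp add: c'_def)
    next
      case False
      then have "e \<in> E" "e \<in> axioms_index"
        using that insert.prems by auto
      then show ?thesis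
        using le[OF axiom_in c(4)] by blast
    qed
    \<comment> \<open>Freshness is inherited: \<open>c\<close> is fixed by the induction hypothesis,
      the new axiom by \<open>henkin_fresh\<close>, and substitution preserves meets.\<close>
    moreover have "fsub A Y Y c' (single A Y (var A Y w) y) = c'" if "fresh_for (insert t E) y" for y
    proof -
      have y: "y \<in> Y - Xs n" "y \<noteq> d n (z, q)" "fresh_for E y"
        using that by (auto simp: fresh_for_def t)
      have "bool_hom (forms A Y) (forms A Y) (\<lambda>p. fsub A Y Y p (single A Y (var A Y w) y))"
        using tower_limit_in y wn by (intro P4 single_in var_in) auto
      then show ?thesis
        using c(1,5) h y henkin_fresh[OF Xs tower_limit_in stage_subset zq index_fresh[OF tI] y(1,2) wn(2)]
        unfolding bool_hom_def c'_def h_def by simp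
    qed
    ultimately show ?thesis
      using ne c' unfolding c'_def by blast
  qed
qed

section \<open>The filter generated by the Henkin axioms\<close>

definition entails :: "'v \<Rightarrow> (nat \<times> 'v \<times> 'v) set \<Rightarrow> 'v \<Rightarrow> bool" where
  "entails r E p \<longleftrightarrow>
    (\<forall>c\<in>fcarrier A Y. ble (forms A Y) c (fsub A (Xs 0) Y r (incl A (Xs 0) Y)) \<longrightarrow>
      (\<forall>t\<in>E. ble (forms A Y) c (axiom t)) \<longrightarrow> ble (forms A Y) c p)"

text \<open>This is the filter generated by the image of \<open>F\<close> and the Henkin axioms.
  Quantifying over common lower bounds in \<open>entails\<close> avoids forming finite meets of
  axioms.\<close>

definition henkin_filter :: "'v set" where
  "henkin_filter =
    {p \<in> fcarrier A Y. \<exists>r\<in>F. \<exists>E. finite E \<and> E \<subseteq> axioms_index \<and> entails r E p}"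

text \<open>The nonzero common lower bound from \<open>ex_lower_bound\<close> lies below every
  entailed element, so 0 is not entailed.\<close>

lemma henkin_filter_bot: "boolalg.bot (forms A Y) \<notin> henkin_filter"
proof
  assume "boolalg.bot (forms A Y) \<in> henkin_filter"
  then obtain r E where "r \<in> F" "finite E" "E \<subseteq> axioms_index"
    and le: "entails r E (boolalg.bot (forms A Y))"
    by (auto simp: henkin_filter_def)
  then obtain c where "c \<in> fcarrier A Y" "c \<noteq> boolalg.bot (forms A Y)"
    "ble (forms A Y) c (boolalg.bot (forms A Y))"
    using ex_lower_bound[of r E] unfolding entails_def by blast
  then show False
    using Y.ble_bot by blast
qed

lemma incl_in_henkin_filter: "r \<in> F \<Longrightarrow> fsub A (Xs 0) Y r (incl A (Xs 0) Y) \<in> henkin_filter"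
  unfolding henkin_filter_def using F(1) w Xs tower_limit_in stage_subset
  by (auto simp: entails_def is_filter_def intro!: fsub_closed incl_in bexI[of _ r] exI[of _ "{}"])

lemma axiom_in_henkin_filter: "t \<in> axioms_index \<Longrightarrow> axiom t \<in> henkin_filter"
  unfolding henkin_filter_def using bool_algebra.filter_top[OF forms_algebra[OF Xs] F(1)] axiom_in
  by (auto simp: entails_def intro!: bexI[of _ "boolalg.top (forms A (Xs 0))"] exI[of _ "{t}"])

lemma henkin_filter_is_filter: "is_filter (forms A Y) henkin_filter"
  unfolding is_filter_def
proof (intro conjI ballI impI)
  show "henkin_filter \<subseteq> fcarrier A Y"
    by (auto simp: henkin_filter_def)
  show "henkin_filter \<noteq> {}"
    using F(1) incl_in_henkin_filter unfolding is_filter_def by blast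
next
  fix p q assume "p \<in> henkin_filter" "q \<in> henkin_filter"
  then obtain r s E D where pq: "p \<in> fcarrier A Y" "q \<in> fcarrier A Y" and rs: "r \<in> F" "s \<in> F"
    and ED: "finite E" "finite D" "E \<subseteq> axioms_index" "D \<subseteq> axioms_index"
    and p: "entails r E p" and q: "entails s D q"
    by (auto simp: henkin_filter_def)
  define k where "k = incl A (Xs 0) Y"
  have k: "k \<in> Xs 0 \<rightarrow>\<^sub>E terms A Y" and ne: "Xs 0 \<noteq> {}"
    using w tower_limit_in stage_subset by (auto simp: k_def intro!: incl_in)
  have rs': "r \<in> fcarrier A (Xs 0)" "s \<in> fcarrier A (Xs 0)" "meet (forms A (Xs 0)) r s \<in> F"
    using F(1) rs by (auto simp: is_filter_def)
  have K: "fsub A (Xs 0) Y r k \<in> fcarrier A Y" "fsub A (Xs 0) Y s k \<in> fcarrier A Y"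
    using Xs ne tower_limit_in rs' k by (auto intro!: fsub_closed)
  have hom: "fsub A (Xs 0) Y (meet (forms A (Xs 0)) r s) k
      = meet (forms A Y) (fsub A (Xs 0) Y r k) (fsub A (Xs 0) Y s k)"
    using P4[OF Xs ne tower_limit_in k] rs' by (auto simp: bool_hom_def)
  \<comment> \<open>The meet of \<open>r\<close> and \<open>s\<close> and the union of the two axiom
    sets entail both \<open>p\<close> and \<open>q\<close>, since the inclusion preserves
    meets.\<close>
  have "ble (forms A Y) c (meet (forms A Y) p q)"
    if c: "c \<in> fcarrier A Y" "ble (forms A Y) c (fsub A (Xs 0) Y (meet (forms A (Xs 0)) r s) k)"
      "\<forall>t\<in>E \<union> D. ble (forms A Y) c (axiom t)" for c
  proof -
    have "ble (forms A Y) c (fsub A (Xs 0) Y r k)" "ble (forms A Y) c (fsub A (Xs 0) Y s k)"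
      using Y.ble_trans[OF c(1) Y.meet_closed[OF K] K(1) _ Y.meet_ble1[OF K]]
        Y.ble_trans[OF c(1) Y.meet_closed[OF K] K(2) _ Y.meet_ble2[OF K]] c(2)
      by (simp_all add: hom)
    then show ?thesis
      using c pq p q by (intro Y.ble_meetI) (auto simp: k_def entails_def)
  qed
  then show "meet (forms A Y) p q \<in> henkin_filter"
    unfolding henkin_filter_def using rs'(3) ED pq
    by (auto simp: k_def entails_def intro!: Y.meet_closed
        bexI[of _ "meet (forms A (Xs 0)) r s"] exI[of _ "E \<union> D"])
next
  fix p q assume "p \<in> henkin_filter" and q: "q \<in> fcarrier A Y" "ble (forms A Y) p q"
  then obtain r E where p: "p \<in> fcarrier A Y" "entails r E p"
    and rE: "r \<in> F" "finite E" "E \<subseteq> axioms_index"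
    by (auto simp: henkin_filter_def)
  have "entails r E q"
    using p(2) Y.ble_trans[OF _ p(1) q(1) _ q(2)] by (simp add: entails_def)
  then show "q \<in> henkin_filter"
    using q(1) rE by (auto simp: henkin_filter_def)
qed

section \<open>Local finiteness and perfectness\<close>

lemma ex_level:
  assumes "finite U" "U \<subseteq> Y"
  shows "\<exists>n. U \<subseteq> Xs n"
  using assms
proof (induction U)
  case (insert u U)
  then obtain m n where "u \<in> Xs m" "U \<subseteq> Xs n"
    by (auto simp: Y_def)
  then have "insert u U \<subseteq> Xs (max m n)"
    using stage_mono[of m "max m n"] stage_mono[of n "max m n"] by auto
  then show ?case ..
qed simp

text \<open>A finite support of \<open>p\<close>, together with \<open>z\<close>, lies in some
  stage. Retracting \<open>Y\<close> onto that stage, with \<open>z\<close> as default value, and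
  including it back fixes the support and hence \<open>p\<close>; the preimage is \<open>p\<close>
  under the retraction.\<close>

lemma ex_preimage:
  assumes lf: "locally_finite S A" and p: "p \<in> fcarrier A Y" and z: "z \<in> Y"
  shows "\<exists>n. z \<in> Xs n \<and> (\<exists>q\<in>fcarrier A (Xs n). p = fsub A (Xs n) Y q (incl A (Xs n) Y))"
proof -
  obtain U where U: "finite U" "form_support S A Y p U"
    using lf p tower_limit_in unfolding locally_finite_def by blast
  then obtain n where n: "insert z U \<subseteq> Xs n"
    using ex_level[of "insert z U"] z unfolding form_support_def by auto
  define \<rho> where "\<rho> = (\<lambda>y\<in>Y. var A (Xs n) (if y \<in> Xs n then y else z))"
  have ne: "Xs n \<noteq> {}" "Y \<noteq> {}"
    using n z by auto
  have \<rho>: "\<rho> \<in> Y \<rightarrow>\<^sub>E terms A (Xs n)" and k: "incl A (Xs n) Y \<in> Xs n \<rightarrow>\<^sub>E terms A Y"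
    using n Xs tower_limit_in stage_subset by (auto simp: \<rho>_def intro!: var_in incl_in)
  define q where "q = fsub A Y (Xs n) p \<rho>"
  have "fsub A (Xs n) Y q (incl A (Xs n) Y) = fsub A Y Y p (scomp A Y (Xs n) Y \<rho> (incl A (Xs n) Y))"
    unfolding q_def by (rule P2_form[OF tower_limit_in ne(2) Xs ne(1) tower_limit_in p \<rho> k])
  also have "\<dots> = fsub A Y Y p (incl A Y Y)"
  proof -
    have "scomp A Y (Xs n) Y \<rho> (incl A (Xs n) Y) \<in> Y \<rightarrow>\<^sub>E terms A Y"
      unfolding scomp_def using \<rho> Xs tower_limit_in ne k by (auto intro!: tsub_closed)
    moreover have "scomp A Y (Xs n) Y \<rho> (incl A (Xs n) Y) u = incl A Y Y u" if "u \<in> U" for u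
      using that n stage_subset[of n] P3[OF Xs _ tower_limit_in k, of u] by (auto simp: scomp_def \<rho>_def incl_def)
    ultimately show ?thesis
      using U(2) ne(2) tower_limit_in incl_in[OF tower_limit_in order_refl] unfolding form_support_def by blast
  qed
  also have "\<dots> = p"
    using P1_form tower_limit_in ne p by blast
  finally have "p = fsub A (Xs n) Y q (incl A (Xs n) Y)" ..
  moreover have "q \<in> fcarrier A (Xs n)"
    unfolding q_def by (rule fsub_closed[OF tower_limit_in ne(2) Xs p \<rho>])
  ultimately show ?thesis
    using n by blast
qed

text \<open>For a formula coming from stage \<open>n\<close>, the term required by perfectness is
  the variable that was adjoined for its preimage \<open>q\<close> and \<open>z\<close>.\<close>

lemma perfect_if_henkin_filter:
  assumes lf: "locally_finite S A" and inf: "infinite (Xs 0)"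
    and I: "ultrafilter (forms A Y) I" "henkin_filter \<subseteq> I"
  shows "perfect_ultrafilter A Y I"
  unfolding perfect_ultrafilter_def
proof (intro conjI ballI I(1))
  interpret I: bool_ultrafilter "forms A Y" I
    using I(1) by unfold_locales
  fix z p assume z: "z \<in> Y" and p: "p \<in> fcarrier A Y"
  obtain n q where n: "z \<in> Xs n" and q: "q \<in> fcarrier A (Xs n)" "p = fsub A (Xs n) Y q (incl A (Xs n) Y)"
    using ex_preimage[OF lf p z] by blast
  then have t: "(n, z, q) \<in> axioms_index"
    by (simp add: axioms_index_def)
  have d: "d n (z, q) \<in> Y - Xs n"
    using index_fresh[OF t] .
  \<comment> \<open>The second variable that \<open>henkin_witness\<close> passes to (Q3).\<close>
  obtain v where v: "v \<in> Xs 0" "v \<noteq> z"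
    using inf by (metis finite.emptyI finite_insert finite_subset insertI1 subsetI)
  have "axiom (n, z, q) \<in> I"
    using axiom_in_henkin_filter[OF t] I(2) by blast
  moreover have "ble (forms A Y) (axiom (n, z, q)) (join (forms A Y) (all A Y z p)
      (neg (forms A Y) (fsub A Y Y p (single A Y (var A Y (d n (z, q))) z))))"
    unfolding axiom_def q(2)
    using henkin_witness[OF Xs tower_limit_in stage_subset n q(1) d, of v] v stage_mono[of 0 n] by auto
  moreover have "var A Y (d n (z, q)) \<in> terms A Y"
    using d tower_limit_in by (auto intro: var_in)
  moreover have "join (forms A Y) (all A Y z p)
      (neg (forms A Y) (fsub A Y Y p (single A Y (var A Y (d n (z, q))) z))) \<in> fcarrier A Y"
    using tower_limit_in z p calculation(3) by (intro Y.bool_closed all_closed fsub_closed single_in) auto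
  ultimately show "\<exists>e\<in>terms A Y. join (forms A Y) (all A Y z p)
      (neg (forms A Y) (fsub A Y Y p (single A Y e z))) \<in> I"
    using I.up_closed by blast
qed

end

lemma ex_perfect_ultrafilter:
  assumes S: "S = {V. small V}" and lf: "locally_finite S A" and X: "X \<in> S" "infinite X"
    and J: "consistent (forms A X) J"
  shows "\<exists>Y I. Y \<in> S \<and> X \<subseteq> Y \<and> perfect_ultrafilter A Y I \<and> (\<forall>p\<in>J. fsub A X Y p (incl A X Y) \<in> I)"
proof -
  obtain Xs :: "nat \<Rightarrow> 'v set" and d where X0: "Xs 0 = X" and Xs: "\<And>n. Xs n \<in> S" "\<And>n. Xs n \<subseteq> Xs (Suc n)"
    and d: "\<And>n. inj_on (d n) (Xs n \<times> fcarrier A (Xs n))"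
      "\<And>n. d n ` (Xs n \<times> fcarrier A (Xs n)) \<subseteq> Xs (Suc n) - Xs n"
    by (rule ex_henkin_tower[OF S X(1)]) (rule that)
  define Y where "Y = (\<Union>n. Xs n)"
  obtain F where F: "is_filter (forms A X) F" "boolalg.bot (forms A X) \<notin> F" "J \<subseteq> F"
    using J bool_algebra.filter_proper_iff[OF forms_algebra[OF X(1)]] unfolding consistent_def by blast
  obtain w where w: "w \<in> X"
    using X(2) by (metis finite.emptyI ex_in_conv)
  note tower = S Xs d Y_def w[folded X0] F(1,2)[folded X0]
  have Y: "Y \<in> S"
    by (rule tower_limit_in[OF tower])
  obtain I where I: "ultrafilter (forms A Y) I" "henkin_filter Xs d Y F \<subseteq> I"
    using bool_algebra.ex_ultrafilter[OF forms_algebra[OF Y] henkin_filter_is_filter[OF tower]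
        henkin_filter_bot[OF tower]] by blast
  have "perfect_ultrafilter A Y I"
    using perfect_if_henkin_filter[OF tower lf _ I] X(2) X0 by simp
  moreover have "\<forall>p\<in>J. fsub A X Y p (incl A X Y) \<in> I"
    using incl_in_henkin_filter[OF tower] F(3) I(2) X0 by auto
  moreover have "X \<subseteq> Y"
    using X0 by (auto simp: Y_def)
  ultimately show ?thesis
    using Y by blast
qed

end


section \<open>The quotient modification\<close>

context quantifier_theory
begin

(* A map into terms A {} cannot be composed with a substitution, so the values of p at two such
   maps are compared through a disjoint double of X. *)
lemma ex_nonclosed_nonempty:
  assumes S: "S = {V. small V}" and X: "X \<in> S" "X \<noteq> {}" and p: "p \<in> fcarrier A X" "\<not> closed_form S A X p"
  shows "\<exists>Y\<in>S - {{}}. \<exists>\<sigma> \<in> X \<rightarrow>\<^sub>E terms A Y. \<exists>\<tau> \<in> X \<rightarrow>\<^sub>E terms A Y. fsub A X Y p \<sigma> \<noteq> fsub A X Y p \<tau>"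
proof -
  obtain Y \<sigma> \<tau> where Y: "Y \<in> S" and st: "\<sigma> \<in> X \<rightarrow>\<^sub>E terms A Y" "\<tau> \<in> X \<rightarrow>\<^sub>E terms A Y"
    and ne: "fsub A X Y p \<sigma> \<noteq> fsub A X Y p \<tau>"
    using p(2) X unfolding closed_form_def form_support_def by auto
  obtain f where f: "inj_on f X" "f ` X \<inter> X = {}"
    using fresh_copy[of X] X(1) S by auto
  define D where "D = X \<union> f ` X"
  have D: "D \<in> S" "D \<noteq> {}"
    using X S by (auto simp: D_def intro!: small_Un small_image)
  \<comment> \<open>One map carries both \<sigma> and \<tau>: after the inclusion of
    \<open>X\<close> it gives \<sigma>, after the renaming \<rho> into the copy it gives \<tau>. If
    the two formulas over \<open>D\<close> were equal, so would be the two values of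
    \<open>p\<close>.\<close>
  define \<mu> where "\<mu> = (\<lambda>y\<in>D. if y \<in> X then \<sigma> y else \<tau> (inv_into X f y))"
  define \<rho> where "\<rho> = (\<lambda>x\<in>X. var A D (f x))"
  have i: "incl A X D \<in> X \<rightarrow>\<^sub>E terms A D"
    using D by (intro incl_in) (auto simp: D_def)
  have \<rho>: "\<rho> \<in> X \<rightarrow>\<^sub>E terms A D"
    using D by (auto simp: \<rho>_def D_def intro!: var_in)
  have \<mu>: "\<mu> \<in> D \<rightarrow>\<^sub>E terms A Y"
    using st f(1) by (auto simp: \<mu>_def D_def PiE_mem)
  have "restrict \<mu> X = \<sigma>"
    using st(1) by (auto simp: \<mu>_def D_def fun_eq_iff restrict_def PiE_def extensional_def)
  then have "scomp A X D Y (incl A X D) \<mu> = \<sigma>"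
    using scomp_incl[OF D(1) Y _ \<mu>, of X] by (simp add: D_def)
  then have 1: "fsub A D Y (fsub A X D p (incl A X D)) \<mu> = fsub A X Y p \<sigma>"
    using P2_form[OF X D Y p(1) i \<mu>] by simp
  have "scomp A X D Y \<rho> \<mu> = \<tau>"
  proof
    fix x
    show "scomp A X D Y \<rho> \<mu> x = \<tau> x"
    proof (cases "x \<in> X")
      case True
      then have "f x \<in> D" "f x \<notin> X"
        using f(2) by (auto simp: D_def)
      then show ?thesis
        using True f(1) P3[OF D(1) _ Y \<mu>, of "f x"] by (simp add: scomp_def \<rho>_def \<mu>_def)
    next
      case False
      then show ?thesis
        using st(2) by (simp add: scomp_def PiE_def extensional_def)
    qed
  qed
  then have "fsub A D Y (fsub A X D p \<rho>) \<mu> = fsub A X Y p \<tau>"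
    using P2_form[OF X D Y p(1) \<rho> \<mu>] by simp
  then have "fsub A X D p (incl A X D) \<noteq> fsub A X D p \<rho>"
    using ne 1 by auto
  then show ?thesis
    using D i \<rho> by blast
qed

(* Since p and its quantification have finite supports, \<sigma> may be replaced by a map whose
   values involve only finitely many variables; then (P5) applies with a fresh y. *)
lemma ex_fresh_instance:
  assumes lf: "locally_finite S A" and X: "X \<in> S" "x \<in> X" and Z: "Z \<in> S" "infinite Z"
    and p: "p \<in> fcarrier A X" and \<sigma>: "\<sigma> \<in> X \<rightarrow>\<^sub>E terms A Z"
  shows "\<exists>y\<in>Z. \<exists>q\<in>fcarrier A Z. fsub A X Z (all A X x p) \<sigma> = all A Z y q \<and>
    (\<forall>d\<in>terms A Z. fsub A X Z p (\<sigma>(x := d)) = fsub A Z Z q (single A Z d y) \<and>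
      fsub A Z Z (all A Z y q) (single A Z d y) = all A Z y q)"
proof -
  have ap: "all A X x p \<in> fcarrier A X"
    using X p by (rule all_closed)
  obtain U V where U: "finite U" "form_support S A X p U"
    and V: "finite V" "form_support S A X (all A X x p) V"
    using lf X p ap unfolding locally_finite_def by meson
  have "\<forall>u\<in>X. \<exists>D. finite D \<and> term_support S A Z (\<sigma> u) D"
    using lf Z(1) \<sigma> unfolding locally_finite_def by (meson PiE_mem)
  then obtain D where D: "\<And>u. u \<in> X \<Longrightarrow> finite (D u)" "\<And>u. u \<in> X \<Longrightarrow> term_support S A Z (\<sigma> u) (D u)"
    by metis
  have UV: "U \<subseteq> X" "V \<subseteq> X"
    using U V by (auto simp: form_support_def)
  obtain w where w: "w \<in> Z"
    using Z(2) by (metis finite.emptyI ex_in_conv)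
  have "finite (insert w (\<Union>u\<in>U \<union> V. D u))"
    using U(1) V(1) D(1) UV by auto
  then have "infinite (Z - insert w (\<Union>u\<in>U \<union> V. D u))"
    using Z(2) by (rule Diff_infinite_finite)
  then have "Z - insert w (\<Union>u\<in>U \<union> V. D u) \<noteq> {}"
    by (metis finite.emptyI)
  then obtain y where y: "y \<in> Z" "y \<noteq> w" "\<And>u. u \<in> U \<union> V \<Longrightarrow> y \<notin> D u"
    by auto
  \<comment> \<open>Off the supports of \<open>p\<close> and of its quantification, values are
    irrelevant; the constant choice \<open>w\<close> avoids \<open>y\<close>, although the original
    values may use it.\<close>
  define \<tau> where "\<tau> = (\<lambda>u\<in>X. if u \<in> U \<union> V then \<sigma> u else var A Z w)"
  have \<tau>: "\<tau> \<in> X \<rightarrow>\<^sub>E terms A Z"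
    using \<sigma> w Z by (auto simp: \<tau>_def intro: var_in)
  \<comment> \<open>On the support \<open>D u\<close>, the map \<open>[d/y]\<close> agrees with the
    identity because \<open>y\<close> is not in \<open>D u\<close>; the remaining values are the
    variable \<open>w\<close>, distinct from \<open>y\<close>.\<close>
  have fixed: "tsub A Z Z (\<tau> u) (single A Z d y) = \<tau> u" if d: "d \<in> terms A Z" and u: "u \<in> X" for u d
  proof (cases "u \<in> U \<union> V")
    case True
    have ne: "Z \<noteq> {}"
      using w by auto
    have "single A Z d y v = incl A Z Z v" if "v \<in> D u" for v
      using that y(3)[OF True] by (auto simp: single_def)
    then have "tsub A Z Z (\<sigma> u) (single A Z d y) = tsub A Z Z (\<sigma> u) (incl A Z Z)"
      using D(2)[OF u] ne Z(1) single_in[OF Z(1) y(1) d] incl_in[OF Z(1) order_refl]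
      unfolding term_support_def by blast
    also have "\<dots> = \<sigma> u"
      using \<sigma> u by (intro P1_term Z(1) ne) auto
    finally show ?thesis
      using True u by (simp add: \<tau>_def)
  next
    case False
    then show ?thesis
      using u w y d Z(1) by (simp add: \<tau>_def tsub_single_var)
  qed
  have ne: "X \<noteq> {}"
    using X by auto
  define q where "q = fsub A X Z p (\<tau>(x := var A Z y))"
  have q: "q \<in> fcarrier A Z"
    unfolding q_def using X Z ne p \<tau> y by (intro fsub_closed PiE_upd var_in)
  have "fsub A X Z (all A X x p) \<sigma> = fsub A X Z (all A X x p) \<tau>"
  proof -
    have "\<forall>u\<in>V. \<sigma> u = \<tau> u"
      using UV by (auto simp: \<tau>_def)
    then show ?thesis
      using V(2) ne Z(1) \<sigma> \<tau> unfolding form_support_def by blast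
  qed
  also have "\<dots> = all A Z y q"
    unfolding q_def using X Z p \<tau> y w fixed[OF var_in[OF Z(1) w]] by (intro fsub_all[where z = w]) auto
  finally have all: "fsub A X Z (all A X x p) \<sigma> = all A Z y q" .
  have "fsub A X Z p (\<sigma>(x := d)) = fsub A Z Z q (single A Z d y)"
    "fsub A Z Z (all A Z y q) (single A Z d y) = all A Z y q" if d: "d \<in> terms A Z" for d
  proof -
    have "\<forall>u\<in>U. (\<sigma>(x := d)) u = (\<tau>(x := d)) u"
      using UV by (auto simp: \<tau>_def)
    then have "fsub A X Z p (\<sigma>(x := d)) = fsub A X Z p (\<tau>(x := d))"
      using U(2) ne Z(1) PiE_upd[OF \<sigma> X(2) d] PiE_upd[OF \<tau> X(2) d] unfolding form_support_def by blast
    then show "fsub A X Z p (\<sigma>(x := d)) = fsub A Z Z q (single A Z d y)"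
      unfolding q_def using X Z p \<tau> y d fixed by (subst fsub_upd_single) auto
    \<comment> \<open>The variable \<open>y\<close> looks bound on the right, and the left side
      shows that it does not occur: no value of \<tau> uses it.\<close>
    have "fsub A X Z (all A X x p) \<tau> = all A Z y q"
      by fact
    then show "fsub A Z Z (all A Z y q) (single A Z d y) = all A Z y q"
      using fsub_single_eq[OF X(1) ne Z(1) ap \<tau> y(1) d] fixed[OF d] by simp
  qed
  then show ?thesis
    using y(1) q all by blast
qed

end

section \<open>The quotient modification as a two-valued model\<close>

locale quotient_modification = quantifier_theory S A + U: small_bool_ultrafilter "forms A Z" I
  for S :: "'v::set_universe set set" and A Z I +
  assumes S_all: "S = {V. small V}" and Z: "Z \<in> S" "infinite Z"
begin

abbreviation "B \<equiv> modif_quot A Z I"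

text \<open>At the empty set the terms of \<open>B\<close> are those of \<open>A\<close> at
  \<open>Z\<close>. With this index most axioms of \<open>B\<close> become instances of those of
  \<open>A\<close>.\<close>

abbreviation "at X \<equiv> (if X = {} then Z else X)"

lemma modif_quot_simps:
  "terms B X = terms A (at X)"
  "var B = var A"
  "forms B X = (if X = {} then quotient_algebra (forms A Z) I else forms A X)"
  "tsub B X Y = tsub A X (at Y)"
  "fsub B X Y p \<sigma> =
    (if Y = {} then quot_class (forms A Z) I (fsub A X Z p \<sigma>) else fsub A X Y p \<sigma>)"
  "all B = all A"
  by (simp_all add: modif_quot_def modif_def)

lemma forms_modif: "x \<in> X \<Longrightarrow> forms B X = forms A X"
  by (auto simp: modif_quot_simps)

lemma scomp_modif: "scomp B X Y W = scomp A X Y (at W)"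
  by (simp add: scomp_def modif_quot_simps fun_eq_iff)

lemma incl_modif: "incl B = incl A"
  by (simp add: incl_def modif_quot_simps fun_eq_iff)

lemma single_modif: "single B = single A"
  by (simp add: single_def incl_modif fun_eq_iff)

lemma at_in: "X \<in> S \<Longrightarrow> at X \<in> S"
  using Z by simp

lemma empty_in_S: "{} \<in> S"
  using S_all small_empty by simp

lemma quot_hom: "bool_hom (forms A Z) (quotient_algebra (forms A Z) I) (quot_class (forms A Z) I)"
  by (rule U.quotient_hom)

lemma quot_in: "p \<in> fcarrier A Z \<Longrightarrow> quot_class (forms A Z) I p \<in> carrier (quotient_algebra (forms A Z) I)"
  by (simp add: U.quotient_simps)

text \<open>Substitution never starts from the empty set, so in any composite the passage to classes
  comes last. The axioms thus follow from those of \<open>A\<close>, with (P4) using that the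
  quotient map is a homomorphism.\<close>

lemma quotient_modification_theory: "quantifier_theory S B"
proof (rule quantifier_theory.intro)
  fix X assume X: "X \<in> S"
  show "small X"
    using X by (rule sets)
  show "small (terms B X)"
    unfolding modif_quot_simps using at_in[OF X] by (rule terms_small)
  show "small (fcarrier B X)"
    using X Z by (auto simp: modif_quot_simps U.quotient_simps intro!: small_image forms_small)
  show "var B X \<in> X \<rightarrow> terms B X"
    using var_closed[OF X] by (auto simp: modif_quot_simps)
  show "bool_algebra (forms B X)"
    using X U.quotient_bool_algebra by (simp add: modif_quot_simps forms_algebra)
next
  show "\<exists>X\<in>S. infinite X"
    by (rule infinite_set)
next
  fix X Y a \<sigma> assume "X \<in> S" "X \<noteq> {}" "Y \<in> S" "a \<in> terms B X" "\<sigma> \<in> X \<rightarrow>\<^sub>E terms B Y"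
  then show "tsub B X Y a \<sigma> \<in> terms B Y"
    unfolding modif_quot_simps by (intro tsub_closed at_in) simp_all
next
  fix X Y p \<sigma> assume "X \<in> S" "X \<noteq> {}" "Y \<in> S" "p \<in> fcarrier B X" "\<sigma> \<in> X \<rightarrow>\<^sub>E terms B Y"
  then show "fsub B X Y p \<sigma> \<in> fcarrier B Y"
    using Z by (cases "Y = {}") (simp_all add: modif_quot_simps fsub_closed quot_in)
next
  fix X x p assume "X \<in> S" "x \<in> X" "p \<in> fcarrier B X"
  then show "all B X x p \<in> fcarrier B X"
    by (simp add: forms_modif modif_quot_simps(6) all_closed)
next
  fix X a assume "X \<in> S" "X \<noteq> {}" "a \<in> terms B X"
  then show "tsub B X X a (incl B X X) = a"
    by (simp add: modif_quot_simps incl_modif P1_term)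
next
  fix X p assume "X \<in> S" "X \<noteq> {}" "p \<in> fcarrier B X"
  then show "fsub B X X p (incl B X X) = p"
    by (simp add: modif_quot_simps incl_modif P1_form)
next
  fix X Y W a \<sigma> \<tau> assume "X \<in> S" "X \<noteq> {}" "Y \<in> S" "Y \<noteq> {}" "W \<in> S" "a \<in> terms B X"
    "\<sigma> \<in> X \<rightarrow>\<^sub>E terms B Y" "\<tau> \<in> Y \<rightarrow>\<^sub>E terms B W"
  then show "tsub B Y W (tsub B X Y a \<sigma>) \<tau> = tsub B X W a (scomp B X Y W \<sigma> \<tau>)"
    using P2_term[of X Y "at W" a \<sigma> \<tau>] Z by (simp add: modif_quot_simps scomp_modif)
next
  fix X Y W p \<sigma> \<tau> assume "X \<in> S" "X \<noteq> {}" "Y \<in> S" "Y \<noteq> {}" "W \<in> S" "p \<in> fcarrier B X"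
    "\<sigma> \<in> X \<rightarrow>\<^sub>E terms B Y" "\<tau> \<in> Y \<rightarrow>\<^sub>E terms B W"
  then show "fsub B Y W (fsub B X Y p \<sigma>) \<tau> = fsub B X W p (scomp B X Y W \<sigma> \<tau>)"
    using P2_form[of X Y "at W" p \<sigma> \<tau>] Z
    by (cases "W = {}") (simp_all add: modif_quot_simps scomp_modif)
next
  fix X x Y \<sigma> assume "X \<in> S" "x \<in> X" "Y \<in> S" "\<sigma> \<in> X \<rightarrow>\<^sub>E terms B Y"
  then show "tsub B X Y (var B X x) \<sigma> = \<sigma> x"
    unfolding modif_quot_simps by (intro P3 at_in)
next
  fix X Y \<sigma> assume h: "X \<in> S" "X \<noteq> {}" "Y \<in> S" "\<sigma> \<in> X \<rightarrow>\<^sub>E terms B Y"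
  then have "bool_hom (forms A X) (forms A (at Y)) (\<lambda>p. fsub A X (at Y) p \<sigma>)"
    unfolding modif_quot_simps by (intro P4 at_in)
  then show "bool_hom (forms B X) (forms B Y) (\<lambda>p. fsub B X Y p \<sigma>)"
    using h(2) bool_hom_comp[OF _ quot_hom] by (cases "Y = {}") (auto simp: modif_quot_simps)
next
  fix X x Y p \<sigma> y z assume h: "X \<in> S" "x \<in> X" "Y \<in> S" "p \<in> fcarrier B X" "\<sigma> \<in> X \<rightarrow>\<^sub>E terms B Y"
    "y \<in> Y" "z \<in> Y" "y \<noteq> z" "scomp B X Y Y \<sigma> (single B Y (var B Y z) y) = \<sigma>"
  then have "X \<noteq> {}" "Y \<noteq> {}"
    by auto
  then show "fsub B X Y (all B X x p) \<sigma> = all B Y y (fsub B X Y p (\<sigma>(x := var B Y y)))"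
    using h P5[of X x Y p \<sigma> y z] by (simp add: modif_quot_simps scomp_modif single_modif)
next
  fix X x p q assume "X \<in> S" "x \<in> X" "p \<in> fcarrier B X" "q \<in> fcarrier B X"
  then show "all B X x (meet (forms B X) p q) = meet (forms B X) (all B X x p) (all B X x q)"
    by (simp add: forms_modif modif_quot_simps(6) Q1)
next
  fix X x p assume "X \<in> S" "x \<in> X" "p \<in> fcarrier B X"
  then show "ble (forms B X) (all B X x p) p"
    by (simp add: forms_modif modif_quot_simps(6) Q2)
next
  fix X x p y assume "X \<in> S" "x \<in> X" "p \<in> fcarrier B X" "y \<in> X" "y \<noteq> x"
    "fsub B X X p (single B X (var B X y) x) = p"
  then show "all B X x p = p"
    using Q3[of X x p y] forms_modif[of x X]
    by (auto simp: modif_quot_simps(2,5,6) single_modif split: if_splits)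
next
  obtain X p where X: "X \<in> S" "X \<noteq> {}" and p: "p \<in> fcarrier A X" "\<not> closed_form S A X p"
    using nontrivial by blast
  \<comment> \<open>A nonempty codomain is essential: there \<open>B\<close> agrees with
    \<open>A\<close>, whereas over the empty set distinct values could fall into the same
    class.\<close>
  obtain Y \<sigma> \<tau> where Y: "Y \<in> S" "Y \<noteq> {}" and st: "\<sigma> \<in> X \<rightarrow>\<^sub>E terms A Y" "\<tau> \<in> X \<rightarrow>\<^sub>E terms A Y"
    and ne: "fsub A X Y p \<sigma> \<noteq> fsub A X Y p \<tau>"
    using ex_nonclosed_nonempty[OF S_all X p] by blast
  have "\<not> closed_form S B X p"
  proof
    assume "closed_form S B X p"
    moreover have "\<sigma> \<in> X \<rightarrow>\<^sub>E terms B Y" "\<tau> \<in> X \<rightarrow>\<^sub>E terms B Y"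
      using st Y(2) by (simp_all add: modif_quot_simps)
    ultimately have "fsub B X Y p \<sigma> = fsub B X Y p \<tau>"
      using X(2) Y(1) unfolding closed_form_def form_support_def by blast
    then show False
      using ne Y by (simp add: modif_quot_simps)
  qed
  then show "\<exists>X\<in>S. X \<noteq> {} \<and> (\<exists>p\<in>fcarrier B X. \<not> closed_form S B X p)"
    using X p(1) by (intro bexI[of _ X] conjI bexI[of _ p]) (auto simp: modif_quot_simps)
qed

lemma is_modification: "modification_of S A B"
  unfolding modification_of_def
proof
  show "quantifier_theory (insert {} S) B"
    using quotient_modification_theory empty_in_S by (simp add: insert_absorb)
  show "agree_on (S - {{}}) A B"
    by (auto simp: agree_on_def same_bool_algebra_def modif_quot_simps)
qed

text \<open>For (M2), \<open>ex_fresh_instance\<close> rewrites all instances as substitutions for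
  \<open>y\<close> in one formula over \<open>Z\<close>; the infimum then becomes a statement about
  membership in \<open>I\<close>.\<close>

lemma is_two_model:
  assumes lf: "locally_finite S A" and perfect: "perfect_ultrafilter A Z I"
  shows "two_model S B"
proof -
  interpret B: quantifier_theory S B
    by (rule quotient_modification_theory)
  show ?thesis
  proof
    show "{} \<in> S"
      by (rule empty_in_S)
    show "terms B {} \<noteq> {}"
      using Z var_in by (fastforce simp: modif_quot_simps)
    show "boolalg.bot (forms B {}) \<noteq> boolalg.top (forms B {})"
      using U.quotient_nontrivial by (simp add: modif_quot_simps)
    show "fcarrier B {} = {boolalg.bot (forms B {}), boolalg.top (forms B {})}"
      using U.quotient_two by (simp add: modif_quot_simps)
    fix X x p \<sigma> assume X: "X \<in> S" "x \<in> X" and "p \<in> fcarrier B X" "\<sigma> \<in> X \<rightarrow>\<^sub>E terms B {}"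
    then have p: "p \<in> fcarrier A X" and \<sigma>: "\<sigma> \<in> X \<rightarrow>\<^sub>E terms A Z" and ne: "X \<noteq> {}"
      by (auto simp: modif_quot_simps split: if_splits)
    obtain y q where y: "y \<in> Z" and q: "q \<in> fcarrier A Z"
      and all: "fsub A X Z (all A X x p) \<sigma> = all A Z y q"
      and inst: "\<And>d. d \<in> terms A Z \<Longrightarrow> fsub A X Z p (\<sigma>(x := d)) = fsub A Z Z q (single A Z d y)"
      and gen: "\<And>d. d \<in> terms A Z \<Longrightarrow> fsub A Z Z (all A Z y q) (single A Z d y) = all A Z y q"
      using ex_fresh_instance[OF lf X Z p \<sigma>] by blast
    have aq: "all A Z y q \<in> fcarrier A Z"
      using Z y q by (intro all_closed)
    have inst_in: "fsub A Z Z q (single A Z d y) \<in> fcarrier A Z" if "d \<in> terms A Z" for d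
      using Z y q that by (intro fsub_closed single_in) auto
    \<comment> \<open>Forwards, (Q2) is carried along \<open>[d/y]\<close>, which fixes the
      quantified formula. Backwards, perfectness supplies one \<open>d\<close> whose instance, being
      in \<open>I\<close>, forces the quantified formula into \<open>I\<close>.\<close>
    have "all A Z y q \<in> I \<longleftrightarrow> (\<forall>d\<in>terms A Z. fsub A Z Z q (single A Z d y) \<in> I)"
    proof (intro iffI ballI)
      fix d assume I: "all A Z y q \<in> I" and d: "d \<in> terms A Z"
      have "bool_hom (forms A Z) (forms A Z) (\<lambda>p. fsub A Z Z p (single A Z d y))"
        using Z y d by (intro P4 single_in) auto
      then have "ble (forms A Z) (fsub A Z Z (all A Z y q) (single A Z d y)) (fsub A Z Z q (single A Z d y))"
        using bool_hom_mono[OF _ aq q Q2[OF Z(1) y q]] by blast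
      then show "fsub A Z Z q (single A Z d y) \<in> I"
        using gen[OF d] I U.up_closed inst_in[OF d] by simp
    next
      assume inst_I: "\<forall>d\<in>terms A Z. fsub A Z Z q (single A Z d y) \<in> I"
      obtain d where d: "d \<in> terms A Z"
        and "join (forms A Z) (all A Z y q) (neg (forms A Z) (fsub A Z Z q (single A Z d y))) \<in> I"
        using perfect y q unfolding perfect_ultrafilter_def by blast
      then show "all A Z y q \<in> I"
        using inst_I aq inst_in[OF d] by (auto simp: U.join_in_iff U.neg_in_iff U.neg_closed)
    qed
    moreover have "(\<lambda>d. fsub B X {} p (\<sigma>(x := d))) ` terms B {}
        = quot_class (forms A Z) I ` (\<lambda>d. fsub A Z Z q (single A Z d y)) ` terms A Z"
      using inst by (auto simp: modif_quot_simps image_image)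
    moreover have "fsub B X {} (all B X x p) \<sigma> = quot_class (forms A Z) I (all A Z y q)"
      using all by (simp add: modif_quot_simps)
    ultimately show "is_infimum (forms B {}) ((\<lambda>d. fsub B X {} p (\<sigma>(x := d))) ` terms B {})
        (fsub B X {} (all B X x p) \<sigma>)"
      using U.quotient_infimumI[OF aq, of "(\<lambda>d. fsub A Z Z q (single A Z d y)) ` terms A Z"] inst_in
      by (auto simp: modif_quot_simps)
  qed
qed

lemma fsub_eq_top:
  assumes "fsub A X Z p \<sigma> \<in> I"
  shows "fsub B X {} p \<sigma> = boolalg.top (forms B {})"
  using assms U.top_in U.top_closed U.sub_carrier
  by (simp add: modif_quot_simps U.quotient_simps U.cls_eq_iff)

end


theorem theorem7:
  fixes S :: "'v::set_universe set set" and A :: "'v qtheory" and X J :: "'v set"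
  assumes "quantifier_theory S A"
    and global: "S = {V. small V}"
    and "locally_finite S A"
    and "small X" and "infinite X"
    and "consistent (forms A X) J"
  shows "(\<exists>X' I. small X' \<and> infinite X' \<and> X \<subseteq> X' \<and> perfect_ultrafilter A X' I \<and>
            {fsub A X X' p (incl A X X') | p. p \<in> J} \<subseteq> I) \<and>
         (\<forall>X' I. small X' \<and> infinite X' \<and> X \<subseteq> X' \<and> perfect_ultrafilter A X' I \<and>
            {fsub A X X' p (incl A X X') | p. p \<in> J} \<subseteq> I \<longrightarrow>
            two_model_of S A (modif_quot A X' I) \<and>
            (\<forall>p\<in>J. fsub (modif_quot A X' I) X {} p (incl A X X') =
                     boolalg.top (forms (modif_quot A X' I) {})))"
proof (intro conjI allI impI)
  interpret quantifier_theory S A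
    by fact
  have X: "X \<in> S"
    using \<open>small X\<close> global by simp
  obtain Y I where "Y \<in> S" "X \<subseteq> Y" "perfect_ultrafilter A Y I"
    "\<forall>p\<in>J. fsub A X Y p (incl A X Y) \<in> I"
    using ex_perfect_ultrafilter[OF global assms(3) X assms(5,6)] by blast
  then show "\<exists>X' I. small X' \<and> infinite X' \<and> X \<subseteq> X' \<and> perfect_ultrafilter A X' I \<and>
      {fsub A X X' p (incl A X X') | p. p \<in> J} \<subseteq> I"
    using global \<open>infinite X\<close> by (intro exI[of _ Y] exI[of _ I]) (auto dest: finite_subset)
next
  fix X' I
  assume h: "small X' \<and> infinite X' \<and> X \<subseteq> X' \<and> perfect_ultrafilter A X' I \<and>
    {fsub A X X' p (incl A X X') | p. p \<in> J} \<subseteq> I"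
  interpret quantifier_theory S A
    by fact
  have X': "X' \<in> S"
    using h global by simp
  interpret quotient_modification S A X' I
    using h X' forms_algebra[OF X'] forms_small[OF X'] global
    by (intro quotient_modification.intro quotient_modification_axioms.intro
        small_bool_ultrafilter.intro small_bool_ultrafilter_axioms.intro
        bool_ultrafilter.intro bool_ultrafilter_axioms.intro assms(1))
      (auto simp: perfect_ultrafilter_def)
  show "two_model_of S A (modif_quot A X' I)"
    using is_modification is_two_model[OF assms(3)] h empty_in_S
    by (simp add: two_model_of_def insert_absorb)
  show "\<forall>p\<in>J. fsub (modif_quot A X' I) X {} p (incl A X X') =
      boolalg.top (forms (modif_quot A X' I) {})"
    using h by (auto intro: fsub_eq_top)
qed

end
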